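(* Let $k\ge 1$, let $\mathcal{Z}$ be a $k$-homogeneous point process on a standard Borel space $S$, and let $f$ be a measurable real-valued function on the set of counting measures on $S$ with total mass $k$ that is Lipschitz-1 with respect to the total variation distance. If $\mathcal{Z}$ has the stochastic covering property, then for every real $a\ge 0$, $$\mathbb{P}\bigl(f(\mathcal{Z})-\mathbb{E}f(\mathcal{Z})\ge a\bigr)\le\exp\left(-\frac{a^2}{8k}\right).$$
   Context: A counting measure on $S$ is a measure taking values in $\{0,1,2,\dots\}\cup\{+\infty\}$; a point process on $S$ is a random counting measure on $S$. It is $k$-homogeneous if its total mass is almost surely $k$; it is then a sum of $k$ point masses. The total variation distance between finite counting measures $\mu,\nu$ is normalized as the total mass of $|\mu-\nu|$, so that $\nu$ and $\nu+\delta_x$ are at distance $1$. Lipschitz-1 means $|f(\mu)-f(\nu)|\le$ this distance. Ordering the $k$ points of $\mathcal{Z}$ uniformly at random gives an exchangeable random sequence $(X_1,\dots,X_k)$ in $S^k$. For $0\le j\le k$, let $\mathcal{Z}_{x_1,\dots,x_j}$ denote the $(k-j)$-homogeneous point process whose law is the (regular) conditional law of $\{X_{j+1},\dots,X_k\}$ (that is, of $\sum_{i=j+1}^k\delta_{X_i}$) given $X_1=x_1,\dots,X_j=x_j$. A point process $\mathcal{Z}$ stochastically covers a point process $\mathcal{W}$ if there is a coupling of their laws supported on pairs $(\mu,\nu)$ of counting measures such that $\mu=\nu$ or $\mu=\nu+\delta_x$ for some $x\in S$. Stochastic covering property: the $k$-homogeneous process $\mathcal{Z}$ has this property if (for a choice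 of the regular conditional laws) $\mathcal{Z}_{x_1,\dots,x_j}$ stochastically covers $\mathcal{Z}_{x_1,\dots,x_{j+1}}$ for all $0\le j<k$ and all choices of $x_1,\dots,x_{j+1}$. *)

theory Defs
  imports "HOL-Probability.Probability"
begin

section \<open>Standard Borel spaces\<close>

definition standard_borel :: "'a measure \<Rightarrow> bool" where
  "standard_borel S \<longleftrightarrow>
     (\<exists>X. topspace X = space S \<and> completely_metrizable_space X \<and> second_countable X \<and>
          sets S = sigma_sets (topspace X) {U. openin X U})"


section \<open>Counting measures and point processes\<close>

text \<open>Throughout, a measurable space is given by \<open>S :: 'a measure\<close>; only \<open>space S\<close> and
  \<open>sets S\<close> are used.\<close>

definition counting_measures :: "'a measure \<Rightarrow> 'a measure set" where
  "counting_measures S =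
     {\<mu>. sets \<mu> = sets S \<and> (\<forall>A\<in>sets S. emeasure \<mu> A \<in> range of_nat \<union> {\<infinity>})}"

text \<open>The sigma-algebra generated by the evaluations \<open>\<mu> \<mapsto> \<mu>(A)\<close>, built in the same way as
  \<^const>\<open>subprob_algebra\<close>.\<close>

definition counting_algebra :: "'a measure \<Rightarrow> 'a measure measure" where
  "counting_algebra S =
     (SUP A \<in> sets S. vimage_algebra (counting_measures S) (\<lambda>\<mu>. emeasure \<mu> A) borel)"

definition point_process :: "'a measure \<Rightarrow> 'w measure \<Rightarrow> ('w \<Rightarrow> 'a measure) \<Rightarrow> bool" where
  "point_process S P Z \<longleftrightarrow> prob_space P \<and> Z \<in> P \<rightarrow>\<^sub>M counting_algebra S"

definition homogeneous :: "'a measure \<Rightarrow> nat \<Rightarrow> 'w measure \<Rightarrow> ('w \<Rightarrow> 'a measure) \<Rightarrow> bool" where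
  "homogeneous S k P Z \<longleftrightarrow> point_process S P Z \<and> (AE \<omega> in P. emeasure (Z \<omega>) (space S) = of_nat k)"

definition configurations :: "'a measure \<Rightarrow> nat \<Rightarrow> 'a measure set" where
  "configurations S k = {\<mu> \<in> counting_measures S. emeasure \<mu> (space S) = of_nat k}"

text \<open>The measure \<open>\<Sum>i\<in>I. \<delta>\<^sub>(\<^sub>x \<^sub>i\<^sub>)\<close>: it gives a set \<open>A\<close> the mass \<open>card {i\<in>I. x i \<in> A}\<close>.\<close>

definition point_masses :: "'a measure \<Rightarrow> 'i set \<Rightarrow> ('i \<Rightarrow> 'a) \<Rightarrow> 'a measure" where
  "point_masses S I x = distr (count_space I) S x"


section \<open>Lipschitz functionals\<close>

text \<open>The total mass of \<open>\<bar>\<mu> - \<nu>\<bar>\<close> for finite measures, as the total variation of the signed measure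
  \<open>\<mu> - \<nu>\<close> (without a factor 1/2, so that \<open>\<nu>\<close> and \<open>\<nu> + \<delta>\<^sub>x\<close> are at distance 1).\<close>

definition tv_dist :: "'a measure \<Rightarrow> 'a measure \<Rightarrow> 'a measure \<Rightarrow> real" where
  "tv_dist S \<mu> \<nu> =
     (SUP F \<in> {F. finite F \<and> F \<subseteq> sets S \<and> partition_on (space S) F}.
        \<Sum>A\<in>F. \<bar>measure \<mu> A - measure \<nu> A\<bar>)"

definition lipschitz1 :: "'a measure \<Rightarrow> nat \<Rightarrow> ('a measure \<Rightarrow> real) \<Rightarrow> bool" where
  "lipschitz1 S k f \<longleftrightarrow>
     (\<forall>\<mu>\<in>configurations S k. \<forall>\<nu>\<in>configurations S k. \<bar>f \<mu> - f \<nu>\<bar> \<le> tv_dist S \<mu> \<nu>)"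


section \<open>Random ordering and conditional laws\<close>

text \<open>The points are numbered \<open>0, \<dots>, k - 1\<close>, so \<open>S\<^sup>j\<close> is \<open>\<Pi>\<^sub>M i\<in>{..<j}. S\<close>.

  For \<open>\<mu>\<close> of total mass \<open>k\<close>, \<open>uniform_ordering S k \<mu>\<close> is the uniform distribution on the finitely many
  sequences \<open>x\<close> with \<open>\<mu> = \<delta>\<^sub>(\<^sub>x \<^sub>0\<^sub>) + \<dots> + \<delta>\<^sub>(\<^sub>x \<^sub>(\<^sub>k\<^sub>-\<^sub>1\<^sub>)\<^sub>)\<close>.
  If \<open>\<mu>\<close> has multiple points this agrees with labelling the points and
  permuting the labels uniformly, because every distinct arrangement comes from the same number of
  permutations. The value on other \<open>\<mu>\<close> is a constant of no importance: such \<open>\<mu>\<close> form a null set.\<close>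

definition uniform_ordering :: "'a measure \<Rightarrow> nat \<Rightarrow> 'a measure \<Rightarrow> (nat \<Rightarrow> 'a) measure" where
  "uniform_ordering S k \<mu> =
     distr (measure_pmf (pmf_of_set {x \<in> {..<k} \<rightarrow>\<^sub>E space S. point_masses S {..<k} x = \<mu>}))
       (\<Pi>\<^sub>M i\<in>{..<k}. S) (\<lambda>x. x)"

text \<open>The law of the exchangeable sequence obtained by randomly ordering a process with law \<open>L\<close>.\<close>

definition random_ordering :: "'a measure \<Rightarrow> nat \<Rightarrow> 'a measure measure \<Rightarrow> (nat \<Rightarrow> 'a) measure" where
  "random_ordering S k L = L \<bind> uniform_ordering S k"

text \<open>\<open>\<kappa>\<close> is a version of the regular conditional law of the remaining points \<open>X\<^sub>j, \<dots>, X\<^sub>k\<^sub>-\<^sub>1\<close>,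
  as a point process, given the first \<open>j\<close> points, where \<open>X\<close> has law \<open>Q\<close>.\<close>

definition remainder_law ::
    "'a measure \<Rightarrow> nat \<Rightarrow> (nat \<Rightarrow> 'a) measure \<Rightarrow> nat \<Rightarrow> ((nat \<Rightarrow> 'a) \<Rightarrow> 'a measure measure) \<Rightarrow> bool"
  where
  "remainder_law S k Q j \<kappa> \<longleftrightarrow>
     \<kappa> \<in> (\<Pi>\<^sub>M i\<in>{..<j}. S) \<rightarrow>\<^sub>M prob_algebra (counting_algebra S) \<and>
     (\<forall>x\<in>space (\<Pi>\<^sub>M i\<in>{..<j}. S). homogeneous S (k - j) (\<kappa> x) (\<lambda>\<mu>. \<mu>)) \<and>
     (\<forall>B\<in>sets (\<Pi>\<^sub>M i\<in>{..<j}. S). \<forall>C\<in>sets (counting_algebra S).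
        emeasure Q {x \<in> space Q. restrict x {..<j} \<in> B \<and> point_masses S {j..<k} x \<in> C} =
        (\<integral>\<^sup>+x. emeasure (\<kappa> (restrict x {..<j})) C * indicator B (restrict x {..<j}) \<partial>Q))"


section \<open>Stochastic covering\<close>

definition covers :: "'a measure \<Rightarrow> 'a measure \<Rightarrow> 'a measure \<Rightarrow> bool" where
  "covers S \<mu> \<nu> \<longleftrightarrow>
     \<mu> = \<nu> \<or> (\<exists>x\<in>space S. \<forall>A\<in>sets S. emeasure \<mu> A = emeasure \<nu> A + emeasure (return S x) A)"

definition stochastically_covers ::
    "'a measure \<Rightarrow> 'a measure measure \<Rightarrow> 'a measure measure \<Rightarrow> bool" where
  "stochastically_covers S L M \<longleftrightarrow>
     (\<exists>C. prob_space C \<and> sets C = sets (counting_algebra S \<Otimes>\<^sub>M counting_algebra S) \<and>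
          distr C (counting_algebra S) fst = L \<and> distr C (counting_algebra S) snd = M \<and>
          (AE (\<mu>, \<nu>) in C. covers S \<mu> \<nu>))"

definition stochastic_covering_property :: "'a measure \<Rightarrow> nat \<Rightarrow> 'a measure measure \<Rightarrow> bool" where
  "stochastic_covering_property S k L \<longleftrightarrow>
     (\<exists>\<kappa>. (\<forall>j\<le>k. remainder_law S k (random_ordering S k L) j (\<kappa> j)) \<and>
          (\<forall>j<k. \<forall>x\<in>space (\<Pi>\<^sub>M i\<in>{..<Suc j}. S).
             stochastically_covers S (\<kappa> j (restrict x {..<j})) (\<kappa> (Suc j) x)))"

end

theory Submission
  imports Defs
begin

text \<open>
  Let \<open>X\<close> be the random ordering of the process and \<open>M\<^sub>j\<close> the conditional expectation of \<open>f\<close> given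
  \<open>X\<^sub>0, \<dots>, X\<^sub>j\<^sub>-\<^sub>1\<close>, that is, the integral of \<open>f (\<delta>\<^sub>X\<^sub>0 + \<dots> + \<delta>\<^sub>X\<^sub>j\<^sub>-\<^sub>1 + \<nu>)\<close> against the law of the remainder \<open>\<nu>\<close>.
  The covering coupling matches the remainder after \<open>j\<close> points with the remainder after \<open>j + 1\<close>
  points plus one extra point, so the configurations that enter \<open>M\<^sub>j\<close> and \<open>M\<^sub>j\<^sub>+\<^sub>1\<close> differ by moving a single point
  and \<open>\<bar>M\<^sub>j\<^sub>+\<^sub>1 - M\<^sub>j\<bar> \<le> 2\<close>. Azuma's inequality with \<open>k\<close> steps of size 2 gives the bound.

  The measure-theoretic price is that ordering a configuration must be a measurable kernel. This needs no
  measurable enumeration of the points: the mass of a rectangle is a function of finitely many counts.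
\<close>

section \<open>Counting measures\<close>

text \<open>The 8 is 2 * 2^2: Azuma's bound reads exp (- a^2 / (2 c^2 k)), and c = 2 because moving
  a point removes one unit of mass and adds another, and total variation counts both. The covering
  is assumed for every choice of points, so the increments are bounded pointwise.
  \<open>random_ordering\<close> is a bind, and the formulas for its measure and integrals require
  \<open>uniform_ordering S k\<close> to be a measurable kernel. Multiple points complicate this:
  the draw is uniform over distinct arrangements, so it is compared with the k! permutations, which
  hit every arrangement equally often. The topology enters through a countable family of sets
  separating points, which splits a configuration into point masses and makes singletons measurable.
  The martingale property takes the form of integral identities against bounded functions of the
  first points, read off the disintegration in \<open>remainder_law\<close>.\<close>

lemma space_counting_algebra [simp]: "space (counting_algebra S) = counting_measures S"
  by (auto simp add: counting_algebra_def space_Sup_eq_UN)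

lemma measurable_emeasure_counting_algebra [measurable]:
  "A \<in> sets S \<Longrightarrow> (\<lambda>\<mu>. emeasure \<mu> A) \<in> borel_measurable (counting_algebra S)"
  by (auto intro!: measurable_Sup1 measurable_vimage_algebra1 simp: counting_algebra_def)

lemma measurable_counting_algebra:
  "(\<And>x. x \<in> space M \<Longrightarrow> K x \<in> counting_measures S) \<Longrightarrow>
   (\<And>A. A \<in> sets S \<Longrightarrow> (\<lambda>x. emeasure (K x) A) \<in> borel_measurable M) \<Longrightarrow>
   K \<in> M \<rightarrow>\<^sub>M counting_algebra S"
  by (auto intro!: measurable_Sup2 measurable_vimage_algebra2 simp: counting_algebra_def)

lemma counting_measures_sets: "\<mu> \<in> counting_measures S \<Longrightarrow> sets \<mu> = sets S"
  by (simp add: counting_measures_def)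

lemma configurations_sets: "\<mu> \<in> configurations S k \<Longrightarrow> sets \<mu> = sets S"
  by (simp add: configurations_def counting_measures_def)

lemma configurations_space: "\<mu> \<in> configurations S k \<Longrightarrow> space \<mu> = space S"
  by (rule sets_eq_imp_space_eq, rule configurations_sets)

lemma configurations_subset: "configurations S k \<subseteq> counting_measures S"
  by (auto simp: configurations_def)

lemma sets_configurations [measurable]: "configurations S k \<in> sets (counting_algebra S)"
proof -
  have "configurations S k = {\<mu> \<in> space (counting_algebra S). emeasure \<mu> (space S) = of_nat k}"
    by (auto simp: configurations_def)
  also have "\<dots> \<in> sets (counting_algebra S)"
    by measurable
  finally show ?thesis .
qed

text \<open>Total mass \<open>k\<close> excludes the value \<infinity>. The set \<open>A\<close> is
  arbitrary: outside the sigma-algebra \<open>emeasure\<close> is 0, which is the case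
  \<open>n = 0\<close>.\<close>

lemma configurations_emeasure:
  assumes "\<mu> \<in> configurations S k"
  obtains n where "n \<le> k" "emeasure \<mu> A = of_nat n"
proof (cases "A \<in> sets S")
  case True
  have le: "emeasure \<mu> A \<le> of_nat k"
    using emeasure_space[of \<mu> A] assms configurations_space[OF assms] by (simp add: configurations_def)
  moreover have "emeasure \<mu> A \<in> range of_nat \<union> {\<infinity>}"
    using assms True by (auto simp: configurations_def counting_measures_def)
  ultimately obtain n where n: "emeasure \<mu> A = of_nat n"
    by (auto simp: top_unique)
  with le have "n \<le> k" by simp
  with n that show ?thesis by blast
next
  case False
  then have "emeasure \<mu> A = of_nat 0"
    using configurations_sets[OF assms] by (simp add: emeasure_notin_sets)
  then show ?thesis using that by blast
qed

lemma finite_measure_configurations: "\<mu> \<in> configurations S k \<Longrightarrow> finite_measure \<mu>"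
  by (rule finite_measureI) (simp add: configurations_space, simp add: configurations_def)

lemma measure_configurations:
  assumes "\<mu> \<in> configurations S k"
  shows "measure \<mu> (space S) = k"
  using assms by (simp add: configurations_def measure_def)

lemma configurations_eqI:
  assumes "\<mu> \<in> configurations S k" "\<nu> \<in> configurations S l"
    and "\<And>A. A \<in> sets S \<Longrightarrow> emeasure \<mu> A = emeasure \<nu> A"
  shows "\<mu> = \<nu>"
  using assms by (intro measure_eqI) (simp_all add: configurations_sets[OF assms(1)] configurations_sets[OF assms(2)])

section \<open>Finite sums of point masses and superposition\<close>

lemma sets_point_masses [simp]: "sets (point_masses S I x) = sets S"
  by (simp add: point_masses_def)

lemma emeasure_point_masses:
  assumes "finite I" "x \<in> I \<rightarrow> space S" "A \<in> sets S"
  shows "emeasure (point_masses S I x) A = of_nat (card {i \<in> I. x i \<in> A})"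
proof -
  have "x -` A \<inter> I = {i \<in> I. x i \<in> A}" by auto
  then show ?thesis
    using assms unfolding point_masses_def by (subst emeasure_distr) (auto simp: emeasure_count_space)
qed

lemma point_masses_in_configurations:
  assumes "finite I" "x \<in> I \<rightarrow> space S"
  shows "point_masses S I x \<in> configurations S (card I)"
proof -
  have "{i \<in> I. x i \<in> space S} = I" using assms by auto
  with assms show ?thesis
    by (auto simp: configurations_def counting_measures_def emeasure_point_masses)
qed

lemma measurable_point_masses:
  assumes "finite I" "I \<subseteq> J"
  shows "point_masses S I \<in> (\<Pi>\<^sub>M i\<in>J. S) \<rightarrow>\<^sub>M counting_algebra S"
proof (rule measurable_counting_algebra)
  fix x assume "x \<in> space (\<Pi>\<^sub>M i\<in>J. S)"
  then have "x \<in> I \<rightarrow> space S" using assms(2) by (auto simp: space_PiM)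
  from point_masses_in_configurations[OF assms(1) this]
  show "point_masses S I x \<in> counting_measures S" using configurations_subset by blast
next
  fix A assume A: "A \<in> sets S"
  have "(\<lambda>x. emeasure (point_masses S I x) A) \<in> borel_measurable (\<Pi>\<^sub>M i\<in>J. S)
     \<longleftrightarrow> (\<lambda>x. \<Sum>i\<in>I. indicator A (x i) :: ennreal) \<in> borel_measurable (\<Pi>\<^sub>M i\<in>J. S)"
  proof (rule measurable_cong)
    fix x assume "x \<in> space (\<Pi>\<^sub>M i\<in>J. S)"
    then have "x \<in> I \<rightarrow> space S" using assms(2) by (auto simp: space_PiM)
    then show "emeasure (point_masses S I x) A = (\<Sum>i\<in>I. indicator A (x i))"
      using assms A
      by (simp add: emeasure_point_masses indicator_def of_bool_def sum.If_cases Int_def)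
  qed
  also have "\<dots>"
    by (intro borel_measurable_sum measurable_compose[OF _ borel_measurable_indicator]
        measurable_component_singleton) (use assms A in auto)
  finally show "(\<lambda>x. emeasure (point_masses S I x) A) \<in> borel_measurable (\<Pi>\<^sub>M i\<in>J. S)" .
qed

text \<open>Superposition, used to put the first points and a remainder back together. The
  sigma-algebra is taken from \<open>\<mu>\<close>, so additivity of the formula relies on
  \<open>sets \<mu> = sets \<nu>\<close>.\<close>

definition plus_measure :: "'a measure \<Rightarrow> 'a measure \<Rightarrow> 'a measure" where
  "plus_measure \<mu> \<nu> = measure_of (space \<mu>) (sets \<mu>) (\<lambda>A. emeasure \<mu> A + emeasure \<nu> A)"

lemma sets_plus_measure [simp]: "sets (plus_measure \<mu> \<nu>) = sets \<mu>"
  by (simp add: plus_measure_def)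

lemma emeasure_plus_measure:
  assumes "sets \<mu> = sets \<nu>"
  shows "emeasure (plus_measure \<mu> \<nu>) A = emeasure \<mu> A + emeasure \<nu> A"
proof (cases "A \<in> sets \<mu>")
  case True
  show ?thesis unfolding plus_measure_def
  proof (rule emeasure_measure_of_sigma)
    show "countably_additive (sets \<mu>) (\<lambda>A. emeasure \<mu> A + emeasure \<nu> A)"
      unfolding countably_additive_def
    proof (intro allI impI)
      fix A :: "nat \<Rightarrow> 'a set" assume A: "range A \<subseteq> sets \<mu>" "disjoint_family A"
      have "(\<Sum>i. emeasure \<mu> (A i) + emeasure \<nu> (A i)) = (\<Sum>i. emeasure \<mu> (A i)) + (\<Sum>i. emeasure \<nu> (A i))"
        by (rule suminf_add[symmetric]) auto
      then show "(\<Sum>i. emeasure \<mu> (A i) + emeasure \<nu> (A i)) = emeasure \<mu> (\<Union>(range A)) + emeasure \<nu> (\<Union>(range A))"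
        using A assms by (simp add: suminf_emeasure)
    qed
  qed (use True in \<open>auto simp: positive_def sets.sigma_algebra_axioms\<close>)
qed (use assms in \<open>simp add: emeasure_notin_sets\<close>)

lemma plus_measure_in_counting_measures:
  assumes "\<mu> \<in> counting_measures S" "\<nu> \<in> counting_measures S"
  shows "plus_measure \<mu> \<nu> \<in> counting_measures S"
proof -
  have "emeasure \<mu> A + emeasure \<nu> A \<in> range of_nat \<union> {\<infinity>}" if "A \<in> sets S" for A
  proof -
    have "emeasure \<mu> A \<in> range of_nat \<union> {\<infinity>}" "emeasure \<nu> A \<in> range of_nat \<union> {\<infinity>}"
      using assms that by (auto simp: counting_measures_def)
    moreover have "of_nat m + of_nat n \<in> range (of_nat :: nat \<Rightarrow> ennreal)" for m n
      by (metis of_nat_add rangeI)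
    ultimately show ?thesis by auto
  qed
  moreover have "sets \<mu> = sets \<nu>"
    using assms by (simp add: counting_measures_sets)
  ultimately show ?thesis
    using counting_measures_sets[OF assms(1)] unfolding counting_measures_def mem_Collect_eq
    by (simp add: emeasure_plus_measure)
qed

lemma plus_measure_in_configurations:
  assumes "\<mu> \<in> configurations S k" "\<nu> \<in> configurations S l"
  shows "plus_measure \<mu> \<nu> \<in> configurations S (k + l)"
proof -
  have *: "sets \<mu> = sets \<nu>"
    using assms by (simp add: configurations_sets)
  have "plus_measure \<mu> \<nu> \<in> counting_measures S"
    using assms configurations_subset by (blast intro: plus_measure_in_counting_measures)
  with assms show ?thesis
    by (simp add: configurations_def emeasure_plus_measure[OF *])
qed

lemma measurable_plus_measure [measurable]:
  assumes [measurable]: "f \<in> M \<rightarrow>\<^sub>M counting_algebra S" "g \<in> M \<rightarrow>\<^sub>M counting_algebra S"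
  shows "(\<lambda>x. plus_measure (f x) (g x)) \<in> M \<rightarrow>\<^sub>M counting_algebra S"
proof (rule measurable_counting_algebra)
  have fg: "f x \<in> counting_measures S" "g x \<in> counting_measures S" if "x \<in> space M" for x
    using assms[THEN measurable_space, OF that] by auto
  show "plus_measure (f x) (g x) \<in> counting_measures S" if "x \<in> space M" for x
    using fg[OF that] by (rule plus_measure_in_counting_measures)
  fix A assume [measurable]: "A \<in> sets S"
  have "(\<lambda>x. emeasure (plus_measure (f x) (g x)) A) \<in> borel_measurable M
    \<longleftrightarrow> (\<lambda>x. emeasure (f x) A + emeasure (g x) A) \<in> borel_measurable M"
    by (rule measurable_cong, rule emeasure_plus_measure)
      (metis fg counting_measures_sets)
  also have "\<dots>"
    using measurable_compose[OF assms(1) measurable_emeasure_counting_algebra, of A]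
      measurable_compose[OF assms(2) measurable_emeasure_counting_algebra, of A] by simp
  finally show "(\<lambda>x. emeasure (plus_measure (f x) (g x)) A) \<in> borel_measurable M" .
qed

section \<open>Configurations as sums of point masses\<close>

text \<open>The family is a countable base. A metrizable space is T1, so \<open>x\<close> has an
  open neighbourhood missing \<open>y\<close>, and some base set around \<open>x\<close> fits inside
  it.\<close>

lemma standard_borel_separating:
  assumes "standard_borel S"
  obtains \<B> where "countable \<B>" "\<B> \<subseteq> sets S"
    "\<And>x y. x \<in> space S \<Longrightarrow> y \<in> space S \<Longrightarrow> x \<noteq> y \<Longrightarrow> \<exists>V\<in>\<B>. x \<in> V \<and> y \<notin> V"
proof -
  from assms obtain X where X: "topspace X = space S" "completely_metrizable_space X"
    "second_countable X" "sets S = sigma_sets (topspace X) {U. openin X U}"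
    unfolding standard_borel_def by (elim exE conjE) (rule that)
  from X(3) obtain \<B> where "countable \<B>" "\<forall>V\<in>\<B>. openin X V"
    "\<forall>U x. openin X U \<and> x \<in> U \<longrightarrow> (\<exists>V\<in>\<B>. x \<in> V \<and> V \<subseteq> U)"
    unfolding second_countable_def by (elim exE conjE) (rule that)
  then have B: "countable \<B>" "\<And>V. V \<in> \<B> \<Longrightarrow> openin X V"
    "\<And>U x. openin X U \<Longrightarrow> x \<in> U \<Longrightarrow> \<exists>V\<in>\<B>. x \<in> V \<and> V \<subseteq> U"
    by simp_all
  have "t1_space X"
    using X(2) completely_metrizable_imp_metrizable_space metrizable_imp_t1_space by blast
  show ?thesis
  proof
    show "countable \<B>" by fact
    show "\<B> \<subseteq> sets S" using B(2) X(4) by auto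
    fix x y assume "x \<in> space S" "y \<in> space S" "x \<noteq> y"
    with \<open>t1_space X\<close> X(1) obtain U where "openin X U" "x \<in> U" "y \<notin> U"
      unfolding t1_space_def by metis
    with B(3) show "\<exists>V\<in>\<B>. x \<in> V \<and> y \<notin> V" by (meson subsetD)
  qed
qed

text \<open>The members of \<open>\<B>\<close> containing \<open>x\<close> have no other common
  point; countability turns this intersection into a measurable set.\<close>

lemma singleton_in_sets:
  assumes "countable \<B>" "\<B> \<subseteq> sets S"
    "\<And>x y. x \<in> space S \<Longrightarrow> y \<in> space S \<Longrightarrow> x \<noteq> y \<Longrightarrow> \<exists>V\<in>\<B>. x \<in> V \<and> y \<notin> V"
    and x: "x \<in> space S"
  shows "{x} \<in> sets S"
proof -
  have "{x} = space S - (\<Union>V\<in>{V \<in> \<B>. x \<in> V}. space S - V)"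
    using assms by blast
  also have "\<dots> \<in> sets S"
    using assms(1,2) by (intro sets.Diff sets.top sets.countable_UN'') auto
  finally show ?thesis .
qed

text \<open>A set of minimal positive mass is an atom; a countable separating family cuts it down to a point.\<close>

lemma configuration_has_point:
  assumes B: "countable \<B>" "\<B> \<subseteq> sets S"
    "\<And>x y. x \<in> space S \<Longrightarrow> y \<in> space S \<Longrightarrow> x \<noteq> y \<Longrightarrow> \<exists>V\<in>\<B>. x \<in> V \<and> y \<notin> V"
    and \<mu>: "\<mu> \<in> configurations S k" and E0: "E\<^sub>0 \<in> sets S" "emeasure \<mu> E\<^sub>0 \<noteq> 0"
  obtains x where "x \<in> E\<^sub>0" "emeasure \<mu> {x} \<noteq> 0"
proof -
  interpret finite_measure \<mu> by (rule finite_measure_configurations[OF \<mu>])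
  note sets_\<mu>[simp] = configurations_sets[OF \<mu>]
  note space_\<mu>[simp] = configurations_space[OF \<mu>]
  define m where "m = (LEAST m. m \<noteq> 0 \<and> (\<exists>E\<in>sets S. E \<subseteq> E\<^sub>0 \<and> emeasure \<mu> E = of_nat m))"
  have ex: "\<exists>m. m \<noteq> 0 \<and> (\<exists>E\<in>sets S. E \<subseteq> E\<^sub>0 \<and> emeasure \<mu> E = of_nat m)"
  proof -
    obtain n where "emeasure \<mu> E\<^sub>0 = of_nat n" by (rule configurations_emeasure[OF \<mu>])
    then show ?thesis using E0 by (intro exI[of _ n] conjI bexI[of _ "E\<^sub>0"]) auto
  qed
  from LeastI_ex[OF ex, folded m_def] obtain E where "m \<noteq> 0" and E: "E \<in> sets S" "E \<subseteq> E\<^sub>0" "emeasure \<mu> E = of_nat m"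
    by (elim conjE bexE) (rule that)
  \<comment> \<open>Masses are natural numbers, so a least positive one exists; monotonicity and
    minimality leave only 0 and \<open>m\<close> as masses of subsets of \<open>E\<close>.\<close>
  have dich: "emeasure \<mu> D = of_nat m" if D: "D \<in> sets S" "D \<subseteq> E" "emeasure \<mu> D \<noteq> 0" for D
  proof -
    obtain n where n: "emeasure \<mu> D = of_nat n" by (rule configurations_emeasure[OF \<mu>])
    have "emeasure \<mu> D \<le> emeasure \<mu> E" using D E by (intro emeasure_mono) auto
    then have "n \<le> m" using n E by simp
    moreover have "m \<le> n" unfolding m_def
      by (rule Least_le) (use D E n in \<open>auto intro!: bexI[of _ D]\<close>)
    ultimately show ?thesis using n by simp
  qed
  have sep: "emeasure \<mu> (E \<inter> V) = 0 \<or> emeasure \<mu> (E - V) = 0" if "V \<in> \<B>" for V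
  proof (rule ccontr)
    assume "\<not> ?thesis"
    then have "emeasure \<mu> (E \<inter> V) = of_nat m" "emeasure \<mu> (E - V) = of_nat m"
      using that B(2) E by (auto intro!: dich)
    moreover have "emeasure \<mu> E = emeasure \<mu> (E \<inter> V) + emeasure \<mu> (E - V)"
      using that B(2) E by (subst plus_emeasure) (auto simp: Int_Diff_Un)
    ultimately have "of_nat m = (of_nat (m + m) :: ennreal)" using E by simp
    then have "m = m + m" by (rule of_nat_eq_iff[THEN iffD1])
    with \<open>m \<noteq> 0\<close> show False by simp
  qed
  \<comment> \<open>\<open>N V\<close> is the negligible half into which \<open>V\<close> cuts
    \<open>E\<close>. Removing countably many of them keeps the mass \<open>m\<close>, and what is
    left lies on one side of every \<open>V\<close>, so it cannot contain two points.\<close>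
  define N where "N V = (if emeasure \<mu> (E \<inter> V) = 0 then E \<inter> V else E - V)" for V
  have N: "N V \<in> null_sets \<mu>" if "V \<in> \<B>" for V
    using sep[OF that] that B(2) E by (auto simp: N_def null_sets_def)
  define D where "D = E - (\<Union>V\<in>\<B>. N V)"
  have nullN: "(\<Union>V\<in>\<B>. N V) \<in> null_sets \<mu>"
    using B(1) N by (rule null_sets_UN')
  have D: "D \<in> sets S" "emeasure \<mu> D = of_nat m"
    unfolding D_def using nullN E by (auto simp: emeasure_Diff_null_set null_sets_def)
  then have "D \<noteq> {}" using \<open>m \<noteq> 0\<close> by auto
  then obtain x where x: "x \<in> D" by blast
  have DS: "D \<subseteq> space S" using D(1) sets.sets_into_space by blast
  have "y = x" if y: "y \<in> D" for y
  proof (rule ccontr)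
    assume "y \<noteq> x"
    then obtain V where V: "V \<in> \<B>" "x \<in> V" "y \<notin> V"
      using B(3)[of x y] x y DS by auto
    with x y have "x \<notin> N V" "y \<notin> N V" "x \<in> E" "y \<in> E" unfolding D_def by auto
    then have "\<not> x \<in> N V" "\<not> y \<in> N V" "x \<in> E" "y \<in> E" by auto
    with V show False by (cases "emeasure \<mu> (E \<inter> V) = 0") (auto simp: N_def)
  qed
  with x have "D = {x}" by blast
  moreover have "x \<in> E\<^sub>0" using x E(2) unfolding D_def by blast
  ultimately show ?thesis
    using that[of x] D(2) \<open>m \<noteq> 0\<close> by simp
qed

text \<open>Each atom has mass at least 1, so there are at most \<open>k\<close> of them. The
  complement of the atoms is null, since otherwise \<open>configuration_has_point\<close> would find
  another atom there. Listing the atoms with multiplicity gives the sequence.\<close>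

lemma configuration_eq_point_masses:
  assumes S: "standard_borel S" and \<mu>: "\<mu> \<in> configurations S k"
  obtains x where "x \<in> {..<k} \<rightarrow>\<^sub>E space S" "point_masses S {..<k} x = \<mu>"
proof -
  obtain \<B> where B: "countable \<B>" "\<B> \<subseteq> sets S"
    "\<And>x y. x \<in> space S \<Longrightarrow> y \<in> space S \<Longrightarrow> x \<noteq> y \<Longrightarrow> \<exists>V\<in>\<B>. x \<in> V \<and> y \<notin> V"
    using standard_borel_separating[OF S] by blast
  note sing = singleton_in_sets[OF B]
  interpret finite_measure \<mu> by (rule finite_measure_configurations[OF \<mu>])
  note sets_\<mu>[simp] = configurations_sets[OF \<mu>]
  note space_\<mu>[simp] = configurations_space[OF \<mu>]
  define T where "T = {x \<in> space S. emeasure \<mu> {x} \<noteq> 0}"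
  have "\<forall>x. \<exists>n. emeasure \<mu> {x} = of_nat n"
    using configurations_emeasure[OF \<mu>] by metis
  then obtain m where m: "\<And>x. emeasure \<mu> {x} = of_nat (m x)" by metis
  have emeasure_fin: "emeasure \<mu> F = of_nat (\<Sum>x\<in>F. m x)" if "finite F" "F \<subseteq> space S" for F
    using that by (subst emeasure_eq_sum_singleton) (auto simp: m intro!: sing)
  have fin: "finite T"
  proof (rule ccontr)
    assume "infinite T"
    then obtain F where F: "F \<subseteq> T" "finite F" "card F = Suc k"
      using infinite_arbitrarily_large by blast
    have "Suc k = (\<Sum>x\<in>F. 1)" using F by simp
    also have "\<dots> \<le> (\<Sum>x\<in>F. m x)"
      by (rule sum_mono) (use F m in \<open>auto simp: T_def Suc_le_eq dest!: subsetD\<close>)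
    also have "\<dots> \<le> k"
    proof -
      have "emeasure \<mu> F \<le> of_nat k"
        using emeasure_space[of \<mu> F] \<mu> by (simp add: configurations_def)
      moreover have "F \<subseteq> space S" using F by (auto simp: T_def)
      ultimately have "of_nat (\<Sum>x\<in>F. m x) \<le> (of_nat k :: ennreal)"
        using emeasure_fin[of F] F by simp
      then show ?thesis by (rule of_nat_le_iff[THEN iffD1])
    qed
    finally show False by simp
  qed
  have TS: "T \<subseteq> space S" by (auto simp: T_def)
  have setsF: "F \<in> sets S" if "F \<subseteq> T" for F
  proof -
    have "finite F" using that fin finite_subset by blast
    moreover have "{x} \<in> sets S" if "x \<in> F" for x
      using that \<open>F \<subseteq> T\<close> TS by (intro sing) auto
    ultimately have "(\<Union>x\<in>F. {x}) \<in> sets S"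
      by (intro sets.finite_UN) auto
    then show ?thesis by simp
  qed
  have null: "emeasure \<mu> (space S - T) = 0"
  proof (rule ccontr)
    assume "emeasure \<mu> (space S - T) \<noteq> 0"
    then obtain x where "x \<in> space S - T" "emeasure \<mu> {x} \<noteq> 0"
      using configuration_has_point[OF B \<mu>, of "space S - T"] setsF[of T] by blast
    then show False by (simp add: T_def)
  qed
  have decomp: "emeasure \<mu> A = of_nat (\<Sum>x\<in>T \<inter> A. m x)" if A: "A \<in> sets S" for A
  proof -
    have "emeasure \<mu> A = emeasure \<mu> (T \<inter> A) + emeasure \<mu> (A - T)"
      using A setsF[of T] by (subst plus_emeasure) (auto intro!: arg_cong[of _ _ "emeasure \<mu>"])
    moreover have "emeasure \<mu> (A - T) \<le> emeasure \<mu> (space S - T)"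
      using A setsF[of T] sets.sets_into_space[OF A] by (intro emeasure_mono) auto
    ultimately show ?thesis
      using null emeasure_fin[of "T \<inter> A"] fin TS by auto
  qed
  \<comment> \<open>Every atom is repeated according to its mass. Any list with this multiset will
    do, as the choice of order never has to be measurable in \<open>\<mu>\<close>.\<close>
  define N where "N = (\<Sum>x\<in>T. replicate_mset (m x) x)"
  obtain xs where xs: "mset xs = N" using ex_mset by blast
  have filter_repl: "filter_mset P (replicate_mset n y) = (if P y then replicate_mset n y else {#})" for P n and y :: 'a
    by (induction n) auto
  have sizeN: "size (filter_mset (\<lambda>x. x \<in> A) N) = (\<Sum>x\<in>T \<inter> A. m x)" for A
  proof -
    have "size (filter_mset (\<lambda>x. x \<in> A) N) = (\<Sum>x\<in>T. if x \<in> A then m x else 0)"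
      unfolding N_def using fin
      by (induction rule: finite_induct) (auto simp: filter_repl)
    then show ?thesis using fin by (simp add: sum.inter_restrict)
  qed
  have setxs: "set xs \<subseteq> T"
  proof -
    have "set xs = set_mset N" using xs by (metis set_mset_mset)
    also have "\<dots> \<subseteq> T" unfolding N_def using fin by (subst set_mset_sum) (auto split: if_splits)
    finally show ?thesis .
  qed
  have len: "length xs = k"
  proof -
    have "filter_mset (\<lambda>x. x \<in> space S) N = N"
    proof -
      have "filter (\<lambda>x. x \<in> space S) xs = xs" using setxs TS by (intro filter_True) auto
      then show ?thesis unfolding xs[symmetric] by (metis mset_filter)
    qed
    then have "length xs = (\<Sum>x\<in>T \<inter> space S. m x)"
      using sizeN[of "space S"] xs by (metis size_mset)
    then have "emeasure \<mu> (space S) = of_nat (length xs)"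
      using decomp[of "space S"] by simp
    then show ?thesis using \<mu> by (simp add: configurations_def)
  qed
  define x where "x = restrict (\<lambda>i. xs ! i) {..<k}"
  have x: "x \<in> {..<k} \<rightarrow>\<^sub>E space S"
    using setxs TS len unfolding x_def by (auto simp: subset_eq)
  have "point_masses S {..<k} x = \<mu>"
  proof (rule configurations_eqI[OF _ \<mu>])
    show "point_masses S {..<k} x \<in> configurations S (card {..<k})"
      using x by (intro point_masses_in_configurations) auto
    fix A assume A: "A \<in> sets S"
    have "card {i \<in> {..<k}. x i \<in> A} = length (filter (\<lambda>x. x \<in> A) xs)"
      unfolding length_filter_conv_card by (rule arg_cong[of _ _ card]) (auto simp: x_def len)
    also have "\<dots> = size (filter_mset (\<lambda>x. x \<in> A) N)"
      unfolding xs[symmetric] by (metis mset_filter size_mset)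
    finally show "emeasure (point_masses S {..<k} x) A = emeasure \<mu> A"
      using x A by (subst emeasure_point_masses) (auto simp: sizeN decomp)
  qed
  with x that show ?thesis by blast
qed

section \<open>The uniform ordering\<close>

definition orderings :: "'a measure \<Rightarrow> nat \<Rightarrow> 'a measure \<Rightarrow> (nat \<Rightarrow> 'a) set" where
  "orderings S k \<mu> = {x \<in> {..<k} \<rightarrow>\<^sub>E space S. point_masses S {..<k} x = \<mu>}"

text \<open>Singletons are measurable, so two orderings of \<open>\<mu>\<close> take each value
  equally often; equal multisets of values means that they differ by a permutation. Conversely,
  permuting indices preserves all counts.\<close>

lemma orderings_eq_image:
  assumes S: "standard_borel S" and X: "X \<in> orderings S k \<mu>"
  shows "orderings S k \<mu> = (\<lambda>\<sigma>. restrict (X \<circ> \<sigma>) {..<k}) ` {\<sigma>. \<sigma> permutes {..<k}}"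
proof (intro equalityI subsetI)
  have XE: "X \<in> {..<k} \<rightarrow>\<^sub>E space S" and X\<mu>: "point_masses S {..<k} X = \<mu>"
    using X by (simp_all add: orderings_def)
  obtain \<B> where B: "countable \<B>" "\<B> \<subseteq> sets S"
    "\<And>x y. x \<in> space S \<Longrightarrow> y \<in> space S \<Longrightarrow> x \<noteq> y \<Longrightarrow> \<exists>V\<in>\<B>. x \<in> V \<and> y \<notin> V"
    using standard_borel_separating[OF S] by blast
  fix x assume "x \<in> orderings S k \<mu>"
  then have xE: "x \<in> {..<k} \<rightarrow>\<^sub>E space S" and x\<mu>: "point_masses S {..<k} x = \<mu>"
    by (simp_all add: orderings_def)
  have "card {i \<in> {..<k}. x i = s} = card {i \<in> {..<k}. X i = s}" for s
  proof (cases "s \<in> space S")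
    case True
    have "emeasure (point_masses S {..<k} x) {s} = emeasure (point_masses S {..<k} X) {s}"
      unfolding x\<mu> X\<mu> ..
    moreover have "emeasure (point_masses S {..<k} y) {s} = of_nat (card {i \<in> {..<k}. y i = s})"
      if "y \<in> {..<k} \<rightarrow>\<^sub>E space S" for y
      using emeasure_point_masses[of "{..<k}" y S "{s}"] that singleton_in_sets[OF B True] by auto
    ultimately show ?thesis using xE XE by simp
  next
    case False
    then have e: "{i \<in> {..<k}. x i = s} = {}" "{i \<in> {..<k}. X i = s} = {}"
      using xE XE by auto
    show ?thesis unfolding e ..
  qed
  then have "image_mset x (mset_set {..<k}) = image_mset X (mset_set {..<k})"
    by (intro multiset_eqI) (simp add: count_image_mset_eq_card_vimage)
  then obtain p where p: "p permutes {..<k}" "\<forall>i\<in>{..<k}. x i = X (p i)"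
    using image_mset_eq_implies_permutes[of "{..<k}" x X] by auto
  then have "x = restrict (X \<circ> p) {..<k}"
    using xE by (auto simp: fun_eq_iff PiE_def extensional_def)
  then show "x \<in> (\<lambda>\<sigma>. restrict (X \<circ> \<sigma>) {..<k}) ` {\<sigma>. \<sigma> permutes {..<k}}"
    using p(1) by blast
next
  have XE: "X \<in> {..<k} \<rightarrow>\<^sub>E space S" and X\<mu>: "point_masses S {..<k} X = \<mu>"
    using X by (simp_all add: orderings_def)
  fix x assume "x \<in> (\<lambda>\<sigma>. restrict (X \<circ> \<sigma>) {..<k}) ` {\<sigma>. \<sigma> permutes {..<k}}"
  then obtain \<sigma> where \<sigma>: "\<sigma> permutes {..<k}" and x: "x = restrict (X \<circ> \<sigma>) {..<k}" by blast
  have \<sigma>k: "\<sigma> i \<in> {..<k}" if "i \<in> {..<k}" for i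
    using that permutes_in_image[OF \<sigma>, of i] by blast
  have xE: "x \<in> {..<k} \<rightarrow>\<^sub>E space S"
    unfolding x restrict_PiE_iff using PiE_mem[OF XE] \<sigma>k by simp
  have xP: "x \<in> {..<k} \<rightarrow> space S" and XP: "X \<in> {..<k} \<rightarrow> space S"
    using xE XE by (simp_all add: PiE_def)
  have "point_masses S {..<k} x = point_masses S {..<k} X"
  proof (rule configurations_eqI)
    show "point_masses S {..<k} x \<in> configurations S (card {..<k})"
      "point_masses S {..<k} X \<in> configurations S (card {..<k})"
      by (rule point_masses_in_configurations[OF finite_lessThan], fact)+
    fix A assume A: "A \<in> sets S"
    have "bij_betw \<sigma> {i \<in> {..<k}. x i \<in> A} {i \<in> {..<k}. X i \<in> A}"
      unfolding bij_betw_def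
    proof
      show "inj_on \<sigma> {i \<in> {..<k}. x i \<in> A}"
        using permutes_inj[OF \<sigma>] by (rule inj_on_subset) simp
      show "\<sigma> ` {i \<in> {..<k}. x i \<in> A} = {i \<in> {..<k}. X i \<in> A}"
      proof (intro equalityI subsetI)
        fix j assume j: "j \<in> {i \<in> {..<k}. X i \<in> A}"
        moreover have "\<sigma> (inv \<sigma> j) = j" by (rule permutes_inverses(1)[OF \<sigma>])
        moreover have "inv \<sigma> j \<in> {..<k}"
          using j permutes_in_image[OF permutes_inv[OF \<sigma>], of j] by blast
        ultimately show "j \<in> \<sigma> ` {i \<in> {..<k}. x i \<in> A}"
          by (intro image_eqI[of _ _ "inv \<sigma> j"]) (auto simp: x)
      qed (use \<sigma>k in \<open>auto simp: x\<close>)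
    qed
    then have "card {i \<in> {..<k}. x i \<in> A} = card {i \<in> {..<k}. X i \<in> A}"
      by (rule bij_betw_same_card)
    then show "emeasure (point_masses S {..<k} x) A = emeasure (point_masses S {..<k} X) A"
      by (simp only: emeasure_point_masses[OF finite_lessThan xP A] emeasure_point_masses[OF finite_lessThan XP A])
  qed
  with xE X\<mu> show "x \<in> orderings S k \<mu>" by (simp add: orderings_def)
qed

section \<open>Counting orderings through permutations\<close>

lemma finite_orderings: 
  assumes "standard_borel S" 
  shows "finite (orderings S k \<mu>)"
proof (cases "orderings S k \<mu> = {}")
  case False
  then obtain X where X: "X \<in> orderings S k \<mu>" by blast
  show ?thesis
    unfolding orderings_eq_image[OF assms X] by (intro finite_imageI finite_permutations) simp
qed simp

text \<open>The fibres of \<open>\<sigma> \<mapsto> X \<circ> \<sigma>\<close> are cosets of the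
  stabiliser of \<open>X\<close>: composing with \<open>inv \<sigma>\<close> on the right carries
  the fibre through \<open>\<sigma>\<close> onto the stabiliser.\<close>

lemma card_fibre_permutes:
  fixes X :: "nat \<Rightarrow> 'a" and k :: nat
  assumes \<sigma>: "\<sigma> permutes {..<k}"
  shows "card {\<tau>. \<tau> permutes {..<k} \<and> restrict (X \<circ> \<tau>) {..<k} = restrict (X \<circ> \<sigma>) {..<k}}
       = card {\<rho>. \<rho> permutes {..<k} \<and> restrict (X \<circ> \<rho>) {..<k} = restrict X {..<k}}"
    (is "card ?A = card ?B")
proof (rule bij_betw_same_card)
  have eq: "restrict f {..<k} = restrict g {..<k} \<longleftrightarrow> (\<forall>i<k. f i = g i)" for f g :: "nat \<Rightarrow> 'a"
    by (auto simp: restrict_def fun_eq_iff)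
  have lt: "p i < k \<longleftrightarrow> i < k" if "p permutes {..<k}" for p i
    using permutes_in_image[OF that, of i] by simp
  show "bij_betw (\<lambda>\<tau>. \<tau> \<circ> inv \<sigma>) ?A ?B"
  proof (rule bij_betwI[where g = "\<lambda>\<rho>. \<rho> \<circ> \<sigma>"])
    show "(\<lambda>\<tau>. \<tau> \<circ> inv \<sigma>) \<in> ?A \<rightarrow> ?B"
      using \<sigma> lt[OF permutes_inv[OF \<sigma>]]
      by (auto simp: eq permutes_inverses intro!: permutes_compose permutes_inv)
    show "(\<lambda>\<rho>. \<rho> \<circ> \<sigma>) \<in> ?B \<rightarrow> ?A"
      using \<sigma> lt[OF \<sigma>] by (auto simp: eq intro!: permutes_compose)
  qed (use \<sigma> in \<open>auto simp: comp_assoc permutes_inv_o\<close>)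
qed

text \<open>Sort the permutations by the arrangement they produce: each arrangement in
  \<open>E\<close> is produced \<open>c\<close> times, where \<open>c\<close> is the order of the
  stabiliser of \<open>X\<close>.\<close>

lemma card_orderings_Int:
  assumes S: "standard_borel S" and X: "X \<in> orderings S k \<mu>"
  defines "c \<equiv> card {\<rho>. \<rho> permutes {..<k} \<and> restrict (X \<circ> \<rho>) {..<k} = restrict X {..<k}}"
  shows "card {\<sigma>. \<sigma> permutes {..<k} \<and> restrict (X \<circ> \<sigma>) {..<k} \<in> E} = c * card (orderings S k \<mu> \<inter> E)"
proof -
  let ?g = "\<lambda>\<sigma>. restrict (X \<circ> \<sigma>) {..<k}"
  have "{\<sigma>. \<sigma> permutes {..<k} \<and> ?g \<sigma> \<in> E}
      = (\<Union>y\<in>orderings S k \<mu> \<inter> E. {\<tau>. \<tau> permutes {..<k} \<and> ?g \<tau> = y})"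
    unfolding orderings_eq_image[OF S X] by auto
  also have "card \<dots> = (\<Sum>y\<in>orderings S k \<mu> \<inter> E. card {\<tau>. \<tau> permutes {..<k} \<and> ?g \<tau> = y})"
    by (rule card_UN_disjoint)
      (auto simp: finite_orderings[OF S] intro: finite_subset[OF _ finite_permutations[of "{..<k}"]])
  also have "\<dots> = (\<Sum>y\<in>orderings S k \<mu> \<inter> E. c)"
  proof (rule sum.cong[OF refl])
    fix y assume "y \<in> orderings S k \<mu> \<inter> E"
    then obtain \<sigma> where "\<sigma> permutes {..<k}" "y = ?g \<sigma>"
      unfolding orderings_eq_image[OF S X] by auto
    then show "card {\<tau>. \<tau> permutes {..<k} \<and> ?g \<tau> = y} = c"
      unfolding c_def by (simp add: card_fibre_permutes)
  qed
  finally show ?thesis by simp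
qed

text \<open>The common multiplicity \<open>c\<close> cancels between the arrangements in
  \<open>E\<close> and all of them, the latter accounting for
  \<open>c * card (orderings S k \<mu>) = k!\<close> permutations. Here \<open>c\<close> is positive
  because the identity fixes \<open>X\<close>. Drawing distinct arrangements thus becomes permuting
  labels, even with ties.\<close>

lemma measure_pmf_of_set_orderings:
  assumes S: "standard_borel S" and X: "X \<in> orderings S k \<mu>"
  shows "measure (measure_pmf (pmf_of_set (orderings S k \<mu>))) E
       = card {\<sigma>. \<sigma> permutes {..<k} \<and> restrict (X \<circ> \<sigma>) {..<k} \<in> E} / fact k"
proof -
  define c where "c = card {\<rho>. \<rho> permutes {..<k} \<and> restrict (X \<circ> \<rho>) {..<k} = restrict X {..<k}}"
  have "finite {\<rho>. \<rho> permutes {..<k} \<and> restrict (X \<circ> \<rho>) {..<k} = restrict X {..<k}}"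
    by (rule finite_subset[OF _ finite_permutations[of "{..<k}"]]) auto
  moreover have "id \<in> {\<rho>. \<rho> permutes {..<k} \<and> restrict (X \<circ> \<rho>) {..<k} = restrict X {..<k}}"
    by (simp add: permutes_id)
  ultimately have "c \<noteq> 0" unfolding c_def using card_gt_0_iff by blast
  have "fact k = card {\<sigma>. \<sigma> permutes {..<k}}"
    using card_permutations[of "{..<k}" k] by simp
  also have "\<dots> = c * card (orderings S k \<mu>)"
    using card_orderings_Int[OF S X, of UNIV] by (simp add: c_def)
  finally have "(fact k :: real) = real c * card (orderings S k \<mu>)"
    by (metis of_nat_fact of_nat_mult)
  moreover have "real (card {\<sigma>. \<sigma> permutes {..<k} \<and> restrict (X \<circ> \<sigma>) {..<k} \<in> E})
     = real c * card (orderings S k \<mu> \<inter> E)"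
    using card_orderings_Int[OF S X, of E] by (simp add: c_def)
  ultimately show ?thesis
    using X \<open>c \<noteq> 0\<close> by (subst measure_pmf_of_set) (auto simp: finite_orderings[OF S])
qed

section \<open>The uniform ordering as a measurable kernel\<close>

lemma uniform_ordering_orderings:
  "uniform_ordering S k \<mu> = distr (measure_pmf (pmf_of_set (orderings S k \<mu>))) (\<Pi>\<^sub>M i\<in>{..<k}. S) (\<lambda>x. x)"
  by (simp add: uniform_ordering_def orderings_def)

lemma sets_uniform_ordering: "sets (uniform_ordering S k \<mu>) = sets (\<Pi>\<^sub>M i\<in>{..<k}. S)"
  by (simp add: uniform_ordering_def)

text \<open>The identity need not be measurable from the full power set into the product, since it may
  leave the space; \<open>distr\<close> nevertheless restricts the measure to the product sigma-algebra.\<close>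

lemma emeasure_uniform_ordering:
  assumes "E \<in> sets (\<Pi>\<^sub>M i\<in>{..<k}. S)"
  shows "emeasure (uniform_ordering S k \<mu>) E = emeasure (measure_pmf (pmf_of_set (orderings S k \<mu>))) E"
  unfolding uniform_ordering_orderings distr_def
proof (subst emeasure_measure_of_sigma)
  let ?p = "measure_pmf (pmf_of_set (orderings S k \<mu>))"
  show "countably_additive (sets (\<Pi>\<^sub>M i\<in>{..<k}. S)) (\<lambda>A. emeasure ?p ((\<lambda>x. x) -` A \<inter> space ?p))"
    unfolding countably_additive_def by (auto intro!: suminf_emeasure)
qed (use assms in \<open>auto simp: positive_def sets.sigma_algebra_axioms\<close>)

text \<open>If \<open>\<mu>\<close> has no ordering, then \<open>pmf_of_set {}\<close> is an
  unspecified distribution that may put mass outside the product space; hence a bound by 1 and not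
  an equality.\<close>

lemma subprob_space_uniform_ordering:
  assumes "space S \<noteq> {}"
  shows "subprob_space (uniform_ordering S k \<mu>)"
proof (rule subprob_spaceI)
  have sp: "space (uniform_ordering S k \<mu>) = space (\<Pi>\<^sub>M i\<in>{..<k}. S)"
    by (simp add: uniform_ordering_def)
  show "emeasure (uniform_ordering S k \<mu>) (space (uniform_ordering S k \<mu>)) \<le> 1"
    unfolding sp by (subst emeasure_uniform_ordering) (auto simp: measure_pmf.emeasure_le_1)
  show "space (uniform_ordering S k \<mu>) \<noteq> {}"
    unfolding sp using assms by (auto simp: space_PiM PiE_eq_empty_iff)
qed

lemma orderings_nonempty:
  assumes "standard_borel S" "\<mu> \<in> configurations S k"
  obtains X where "X \<in> orderings S k \<mu>"
  by (rule configuration_eq_point_masses[OF assms]) (auto simp: orderings_def intro: that)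

lemma orderings_empty:
  assumes "\<mu> \<notin> configurations S k"
  shows "orderings S k \<mu> = {}"
proof -
  have "point_masses S {..<k} x \<in> configurations S k" if "x \<in> {..<k} \<rightarrow>\<^sub>E space S" for x
    using point_masses_in_configurations[of "{..<k}" x S] that by (auto simp: PiE_def)
  with assms show ?thesis by (auto simp: orderings_def)
qed

text \<open>The mass that the uniform ordering of \<open>\<mu>\<close> gives to a rectangle \<open>A\<^sub>0 \<times> \<dots> \<times> A\<^sub>k\<^sub>-\<^sub>1\<close> depends only on
  how many points of \<open>\<mu>\<close> have each type, where the type of a point is the set of \<open>i\<close> such that
  the point lies in \<open>A\<^sub>i\<close>.\<close>

lemma measure_orderings_rectangle_cong:
  fixes k :: nat and S :: "'a measure"
  assumes S: "standard_borel S" and A: "\<And>i. i < k \<Longrightarrow> A i \<in> sets S"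
    and \<mu>: "\<mu> \<in> configurations S k" and \<nu>: "\<nu> \<in> configurations S k"
    and eq: "\<And>t. t \<subseteq> {..<k} \<Longrightarrow> emeasure \<mu> {s \<in> space S. {i\<in>{..<k}. s \<in> A i} = t}
                        = emeasure \<nu> {s \<in> space S. {i\<in>{..<k}. s \<in> A i} = t}"
    and type_sets: "\<And>t. {s \<in> space S. {i\<in>{..<k}. s \<in> A i} = t} \<in> sets S"
  shows "measure (measure_pmf (pmf_of_set (orderings S k \<mu>))) (PiE {..<k} A)
       = measure (measure_pmf (pmf_of_set (orderings S k \<nu>))) (PiE {..<k} A)"
proof -
  define \<tau> where "\<tau> s = {i\<in>{..<k}. s \<in> A i}" for s
  obtain X where X: "X \<in> orderings S k \<mu>" by (rule orderings_nonempty[OF S \<mu>])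
  obtain Y where Y: "Y \<in> orderings S k \<nu>" by (rule orderings_nonempty[OF S \<nu>])
  have count: "emeasure \<xi> {s \<in> space S. \<tau> s = t} = of_nat (card {i \<in> {..<k}. \<tau> (Z i) = t})"
    if "Z \<in> orderings S k \<xi>" for Z t \<xi>
  proof -
    have Z: "Z \<in> {..<k} \<rightarrow> space S" "point_masses S {..<k} Z = \<xi>"
      using that by (auto simp: orderings_def PiE_def)
    have "{i \<in> {..<k}. Z i \<in> {s \<in> space S. \<tau> s = t}} = {i \<in> {..<k}. \<tau> (Z i) = t}"
      using Z(1) by auto
    with emeasure_point_masses[OF finite_lessThan Z(1) type_sets[of t]] Z(2) show ?thesis
      by (simp add: \<tau>_def)
  qed
  have "card {i \<in> {..<k}. \<tau> (X i) = t} = card {i \<in> {..<k}. \<tau> (Y i) = t}" for t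
  proof (cases "t \<subseteq> {..<k}")
    case True
    from eq[OF this] have "emeasure \<mu> {s \<in> space S. \<tau> s = t} = emeasure \<nu> {s \<in> space S. \<tau> s = t}"
      by (simp add: \<tau>_def)
    then show ?thesis unfolding count[OF X] count[OF Y] by (rule of_nat_eq_iff[THEN iffD1])
  next
    case False
    then have e: "{i \<in> {..<k}. \<tau> (X i) = t} = {}" "{i \<in> {..<k}. \<tau> (Y i) = t} = {}"
      by (auto simp: \<tau>_def)
    show ?thesis unfolding e ..
  qed
  \<comment> \<open>Equal counts of every type mean equal multisets of types, so some
    \<open>p\<close> matches the points of \<open>X\<close> with points of \<open>Y\<close> of the
    same type.\<close>
  then have "image_mset (\<lambda>i. \<tau> (X i)) (mset_set {..<k}) = image_mset (\<lambda>i. \<tau> (Y i)) (mset_set {..<k})"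
    by (intro multiset_eqI) (simp add: count_image_mset_eq_card_vimage)
  then obtain p where p: "p permutes {..<k}" and "\<forall>i\<in>{..<k}. \<tau> (X i) = \<tau> (Y (p i))"
    by (rule image_mset_eq_implies_permutes[OF finite_lessThan])
  then have XY: "\<tau> (X i) = \<tau> (Y (p i))" if "i < k" for i
    using that by simp
  have lt: "\<sigma> i < k" if "\<sigma> permutes {..<k}" "i < k" for \<sigma> i
    using that permutes_in_image[of \<sigma> "{..<k}" i] by simp
  have rect: "{\<sigma>. \<sigma> permutes {..<k} \<and> restrict (Z \<circ> \<sigma>) {..<k} \<in> PiE {..<k} A}
      = {\<sigma>. \<sigma> permutes {..<k} \<and> (\<forall>i<k. i \<in> \<tau> (Z (\<sigma> i)))}" for Z
    by (auto simp: restrict_PiE_iff \<tau>_def)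
  \<comment> \<open>Whether an arrangement lies in the rectangle depends only on the types of its
    entries, so relabelling by \<open>p\<close> maps the favourable permutations for
    \<open>X\<close> bijectively to those for \<open>Y\<close>.\<close>
  have "bij_betw (\<lambda>\<sigma>. p \<circ> \<sigma>) {\<sigma>. \<sigma> permutes {..<k} \<and> (\<forall>i<k. i \<in> \<tau> (X (\<sigma> i)))}
      {\<sigma>. \<sigma> permutes {..<k} \<and> (\<forall>i<k. i \<in> \<tau> (Y (\<sigma> i)))}"
  proof (rule bij_betwI[where g = "\<lambda>\<sigma>. inv p \<circ> \<sigma>"])
    show "(\<lambda>\<sigma>. p \<circ> \<sigma>) \<in> {\<sigma>. \<sigma> permutes {..<k} \<and> (\<forall>i<k. i \<in> \<tau> (X (\<sigma> i)))}
      \<rightarrow> {\<sigma>. \<sigma> permutes {..<k} \<and> (\<forall>i<k. i \<in> \<tau> (Y (\<sigma> i)))}"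
      using p by (auto intro: permutes_compose simp: lt XY[symmetric])
    show "(\<lambda>\<sigma>. inv p \<circ> \<sigma>) \<in> {\<sigma>. \<sigma> permutes {..<k} \<and> (\<forall>i<k. i \<in> \<tau> (Y (\<sigma> i)))}
      \<rightarrow> {\<sigma>. \<sigma> permutes {..<k} \<and> (\<forall>i<k. i \<in> \<tau> (X (\<sigma> i)))}"
      using p permutes_inv[OF p]
      by (auto intro: permutes_compose simp: lt XY permutes_inverses[OF p])
  qed (simp_all add: comp_assoc[symmetric] permutes_inv_o[OF p])
  then show ?thesis
    unfolding measure_pmf_of_set_orderings[OF S X] measure_pmf_of_set_orderings[OF S Y] rect
    by (simp add: bij_betw_same_card)
qed

text \<open>Rectangles form an intersection-stable generator, so they suffice. On configurations,
  the mass of a rectangle factors through the vector of type counts, which lives in a countable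
  discrete space; every function on such a space is measurable.\<close>

lemma measurable_uniform_ordering:
  assumes S: "standard_borel S" "space S \<noteq> {}"
  shows "uniform_ordering S k \<in> counting_algebra S \<rightarrow>\<^sub>M subprob_algebra (\<Pi>\<^sub>M i\<in>{..<k}. S)"
proof (rule measurable_subprob_algebra_generated[OF sets_PiM Int_stable_prod_algebra prod_algebra_sets_into_space])
  show "subprob_space (uniform_ordering S k \<mu>)" for \<mu> by (rule subprob_space_uniform_ordering[OF S(2)])
  show "sets (uniform_ordering S k \<mu>) = sets (\<Pi>\<^sub>M i\<in>{..<k}. S)" for \<mu> by (rule sets_uniform_ordering)
  have rect: "(\<lambda>\<mu>. emeasure (uniform_ordering S k \<mu>) (PiE {..<k} A)) \<in> borel_measurable (counting_algebra S)"
    if A: "\<And>i. i < k \<Longrightarrow> A i \<in> sets S" for A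
  proof -
    define D where "D t = {s \<in> space S. {i\<in>{..<k}. s \<in> A i} = t}" for t
    have D [measurable]: "D t \<in> sets S" for t
    proof -
      have "D t = {s \<in> space S. \<forall>i\<in>{..<k}. (s \<in> A i) = (i \<in> t)} \<inter> {s \<in> space S. t \<subseteq> {..<k}}"
        unfolding D_def by blast
      also have "\<dots> \<in> sets S"
      proof (intro sets.Int sets.sets_Collect_finite_All sets.sets_Collect_const)
        fix i assume "i \<in> {..<k}"
        then have "A i \<in> sets S" using A by simp
        then have "{s \<in> space S. s \<in> A i} \<in> sets S" 
          using sets.sets_into_space[of "A i" S] by (simp add: Collect_conj_eq Int_absorb1)
        then show "{s \<in> space S. (s \<in> A i) = (i \<in> t)} \<in> sets S"
          by (cases "i \<in> t") (auto intro: sets.sets_Collect_neg)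
      qed simp
      finally show ?thesis .
    qed
    define u where "u \<mu> = emeasure (measure_pmf (pmf_of_set (orderings S k \<mu>))) (PiE {..<k} A)" for \<mu>
    define g where "g \<mu> = (\<lambda>t\<in>Pow {..<k}. nat \<lfloor>enn2real (emeasure \<mu> (D t))\<rfloor>)" for \<mu>
    let ?I = "Pow {..<k} \<rightarrow>\<^sub>E (UNIV :: nat set)"
    have u_cong: "u \<mu> = u \<nu>" if "\<mu> \<in> configurations S k" "\<nu> \<in> configurations S k" "g \<mu> = g \<nu>" for \<mu> \<nu>
    proof -
      have "emeasure \<mu> (D t) = emeasure \<nu> (D t)" if t: "t \<subseteq> {..<k}" for t
      proof -
        obtain m where m: "emeasure \<mu> (D t) = of_nat m"
          by (rule configurations_emeasure[OF \<open>\<mu> \<in> configurations S k\<close>])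
        obtain n where n: "emeasure \<nu> (D t) = of_nat n"
          by (rule configurations_emeasure[OF \<open>\<nu> \<in> configurations S k\<close>])
        have "g \<mu> t = m" "g \<nu> t = n" using t m n by (simp_all add: g_def)
        with m n \<open>g \<mu> = g \<nu>\<close> show ?thesis by simp
      qed
      then show ?thesis
        unfolding u_def measure_pmf.emeasure_eq_measure
        using measure_orderings_rectangle_cong[OF S(1) A that(1,2)] D unfolding D_def by simp
    qed
    \<comment> \<open>By \<open>u_cong\<close> the value does not depend on which configuration with
      counts \<open>c\<close> is chosen. The domain is discrete, so the choice causes no
      measurability problem.\<close>
    define H where "H c = u (SOME \<nu>. \<nu> \<in> configurations S k \<and> g \<nu> = c)" for c
    have uH: "u \<mu> = H (g \<mu>)" if "\<mu> \<in> configurations S k" for \<mu>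
    proof -
      have "(SOME \<nu>. \<nu> \<in> configurations S k \<and> g \<nu> = g \<mu>) \<in> configurations S k
          \<and> g (SOME \<nu>. \<nu> \<in> configurations S k \<and> g \<nu> = g \<mu>) = g \<mu>"
        by (rule someI[of _ \<mu>]) (intro conjI refl that)
      then show ?thesis unfolding H_def by (intro u_cong that) simp_all
    qed
    have g: "g \<in> counting_algebra S \<rightarrow>\<^sub>M count_space ?I"
    proof (subst measurable_count_space_eq_countable)
      show "countable ?I" by (intro countable_PiE) auto
      have gI: "g \<mu> \<in> ?I" for \<mu> unfolding g_def by (simp only: restrict_PiE_iff UNIV_I ball_triv simp_thms)
      have "g -` {c} \<inter> space (counting_algebra S) \<in> sets (counting_algebra S)" if "c \<in> ?I" for c
      proof -
        have "g -` {c} \<inter> space (counting_algebra S) =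
           {\<mu> \<in> space (counting_algebra S). \<forall>t\<in>Pow {..<k}. nat \<lfloor>enn2real (emeasure \<mu> (D t))\<rfloor> = c t}"
        proof -
          have "g \<mu> = c \<longleftrightarrow> (\<forall>t\<in>Pow {..<k}. g \<mu> t = c t)" for \<mu>
            using PiE_ext[of "g \<mu>" "Pow {..<k}" "\<lambda>_. UNIV" c] gI that by blast
          then have "g \<mu> = c \<longleftrightarrow> (\<forall>t\<in>Pow {..<k}. nat \<lfloor>enn2real (emeasure \<mu> (D t))\<rfloor> = c t)" for \<mu>
            by (simp only: g_def restrict_apply cong: ball_cong) simp
          then show ?thesis by blast
        qed
        also have "\<dots> \<in> sets (counting_algebra S)"
        proof (rule sets.sets_Collect_finite_All)
          fix t
          have "(\<lambda>\<mu>. nat \<lfloor>enn2real (emeasure \<mu> (D t))\<rfloor>) \<in> counting_algebra S \<rightarrow>\<^sub>M count_space UNIV"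
            by (rule measurable_compose[OF measurable_emeasure_counting_algebra[OF D]]) measurable
          then show "{\<mu> \<in> space (counting_algebra S). nat \<lfloor>enn2real (emeasure \<mu> (D t))\<rfloor> = c t} \<in> sets (counting_algebra S)"
            by measurable
        qed simp
        finally show ?thesis .
      qed
      moreover have "g \<in> space (counting_algebra S) \<rightarrow> ?I" using gI by blast
      ultimately show "g \<in> space (counting_algebra S) \<rightarrow> ?I \<and>
          (\<forall>c\<in>?I. g -` {c} \<inter> space (counting_algebra S) \<in> sets (counting_algebra S))" by blast
    qed
    have "(\<lambda>\<mu>. H (g \<mu>)) \<in> borel_measurable (counting_algebra S)"
      by (rule measurable_compose[OF g]) simp
    \<comment> \<open>Off the configurations there are no orderings, and the mass is a constant
      given by the unspecified \<open>pmf_of_set {}\<close>.\<close>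
    then have "(\<lambda>\<mu>. if \<mu> \<in> configurations S k then H (g \<mu>)
        else emeasure (measure_pmf (pmf_of_set {})) (PiE {..<k} A)) \<in> borel_measurable (counting_algebra S)"
      by measurable
    moreover have "PiE {..<k} A \<in> sets (\<Pi>\<^sub>M i\<in>{..<k}. S)"
      using A by (intro sets_PiM_I_finite) auto
    then have "emeasure (uniform_ordering S k \<mu>) (PiE {..<k} A) =
        (if \<mu> \<in> configurations S k then H (g \<mu>) else emeasure (measure_pmf (pmf_of_set {})) (PiE {..<k} A))" for \<mu>
      by (simp add: emeasure_uniform_ordering orderings_empty uH[symmetric] u_def)
    ultimately show ?thesis by simp
  qed
  show "(\<lambda>\<mu>. emeasure (uniform_ordering S k \<mu>) (\<Pi>\<^sub>E i\<in>{..<k}. space S)) \<in> borel_measurable (counting_algebra S)"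
    by (rule rect) simp
  fix E assume "E \<in> prod_algebra {..<k} (\<lambda>i. S)"
  then obtain A where "E = PiE {..<k} A" "\<And>i. i < k \<Longrightarrow> A i \<in> sets S"
    by (auto simp: prod_algebra_eq_finite)
  then show "(\<lambda>\<mu>. emeasure (uniform_ordering S k \<mu>) E) \<in> borel_measurable (counting_algebra S)"
    using rect by blast
qed

section \<open>The law of the randomly ordered sequence\<close>

locale homogeneous_law =
  fixes S :: "'a measure" and k :: nat and L :: "'a measure measure"
  assumes standard_borel: "standard_borel S" and nonempty: "space S \<noteq> {}"
    and prob_L: "prob_space L" and sets_L: "sets L = sets (counting_algebra S)"
    and AE_L: "AE \<mu> in L. \<mu> \<in> configurations S k"
begin

abbreviation "Q \<equiv> random_ordering S k L"
abbreviation "PS J \<equiv> \<Pi>\<^sub>M i\<in>J. S"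

lemma space_L: "space L = counting_measures S"
  using sets_eq_imp_space_eq[OF sets_L] by simp

lemma measurable_uniform_ordering_L: "uniform_ordering S k \<in> L \<rightarrow>\<^sub>M subprob_algebra (PS {..<k})"
  using measurable_uniform_ordering[OF standard_borel nonempty]
  by (simp cong: measurable_cong_sets add: sets_L)

lemma space_L_nonempty: "space L \<noteq> {}"
  using prob_space.not_empty[OF prob_L] .

lemma sets_Q [measurable_cong, simp]: "sets Q = sets (PS {..<k})"
  unfolding random_ordering_def
  by (rule sets_bind_measurable[OF measurable_uniform_ordering_L space_L_nonempty])

lemma space_Q [simp]: "space Q = space (PS {..<k})"
  by (rule sets_eq_imp_space_eq[OF sets_Q])

text \<open>Forgetting the order undoes the random ordering: all orderings of \<open>\<mu>\<close>
  have \<open>\<mu>\<close> as their sum of point masses, so given \<open>\<mu>\<close> the event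
  has probability 0 or 1 according to whether \<open>\<mu> \<in> C\<close>.\<close>

lemma emeasure_Q_point_masses:
  assumes C: "C \<in> sets (counting_algebra S)"
  shows "emeasure Q (point_masses S {..<k} -` C \<inter> space (PS {..<k})) = emeasure L C"
proof -
  let ?E = "point_masses S {..<k} -` C \<inter> space (PS {..<k})"
  have E: "?E \<in> sets (PS {..<k})"
    by (rule measurable_sets[OF measurable_point_masses C]) auto
  have "emeasure Q ?E = (\<integral>\<^sup>+\<mu>. emeasure (uniform_ordering S k \<mu>) ?E \<partial>L)"
    unfolding random_ordering_def
    by (rule emeasure_bind[OF space_L_nonempty measurable_uniform_ordering_L E])
  also have "\<dots> = (\<integral>\<^sup>+\<mu>. indicator C \<mu> \<partial>L)"
  proof (rule nn_integral_cong_AE, use AE_L in eventually_elim)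
    fix \<mu> assume \<mu>: "\<mu> \<in> configurations S k"
    obtain X where "X \<in> orderings S k \<mu>" by (rule orderings_nonempty[OF standard_borel \<mu>])
    then have ne: "orderings S k \<mu> \<noteq> {}" by auto
    have Int: "orderings S k \<mu> \<inter> ?E = (if \<mu> \<in> C then orderings S k \<mu> else {})"
      by (auto simp: orderings_def space_PiM)
    show "emeasure (uniform_ordering S k \<mu>) ?E = indicator C \<mu>"
      unfolding emeasure_uniform_ordering[OF E]
      using ne by (subst emeasure_pmf_of_set[OF ne finite_orderings[OF standard_borel]])
        (simp add: Int finite_orderings[OF standard_borel])
  qed
  also have "\<dots> = emeasure L C"
    using C by (simp add: sets_L)
  finally show ?thesis .
qed

text \<open>The kernel is only known to be a subprobability, so the total mass is read off
  \<open>emeasure_Q_point_masses\<close> with the whole space for \<open>C\<close>.\<close>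

lemma prob_space_Q: "prob_space Q"
proof (rule prob_spaceI)
  have "point_masses S {..<k} -` space (counting_algebra S) \<inter> space (PS {..<k}) = space (PS {..<k})"
    using measurable_space[OF measurable_point_masses[of "{..<k}" "{..<k}" S]] by auto
  then show "emeasure Q (space Q) = 1"
    using emeasure_Q_point_masses[OF sets.top] prob_space.emeasure_space_1[OF prob_L] 
    by (simp add: space_L)
qed

lemma distr_point_masses_Q: "distr Q (counting_algebra S) (point_masses S {..<k}) = L"
proof (rule measure_eqI)
  have m: "point_masses S {..<k} \<in> Q \<rightarrow>\<^sub>M counting_algebra S"
    using measurable_point_masses[of "{..<k}" "{..<k}" S] by (simp cong: measurable_cong_sets)
  fix C assume "C \<in> sets (distr Q (counting_algebra S) (point_masses S {..<k}))"
  then show "emeasure (distr Q (counting_algebra S) (point_masses S {..<k})) C = emeasure L C"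
    using emeasure_Q_point_masses[of C] by (simp add: emeasure_distr[OF m])
qed (simp add: sets_L)

end

section \<open>Disintegration along the first points\<close>

text \<open>Attaching the conditioning value to the draw turns a conditional law into a kernel on
  the product, so that integrands may depend on both coordinates.\<close>

lemma kernel_pair:
  assumes \<kappa>: "\<kappa> \<in> M \<rightarrow>\<^sub>M prob_algebra N"
  shows "(\<lambda>y. distr (\<kappa> y) (M \<Otimes>\<^sub>M N) (Pair y)) \<in> M \<rightarrow>\<^sub>M prob_algebra (M \<Otimes>\<^sub>M N)"
  by (rule measurable_distr_prob_space2[OF \<kappa>]) simp

lemma kernel_Pair_measurable:
  assumes "\<kappa> \<in> M \<rightarrow>\<^sub>M prob_algebra N" "y \<in> space M"
  shows "Pair y \<in> \<kappa> y \<rightarrow>\<^sub>M M \<Otimes>\<^sub>M N" "prob_space (\<kappa> y)" "sets (\<kappa> y) = sets N"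
proof -
  have "\<kappa> y \<in> space (prob_algebra N)" using measurable_space[OF assms] .
  then show *: "prob_space (\<kappa> y)" "sets (\<kappa> y) = sets N" by (simp_all add: space_prob_algebra)
  show "Pair y \<in> \<kappa> y \<rightarrow>\<^sub>M M \<Otimes>\<^sub>M N"
    using measurable_Pair1'[OF assms(2), of N] measurable_cong_sets[OF *(2) refl] by blast
qed

lemma borel_measurable_kernel_integral:
  fixes h :: "'a \<times> 'b \<Rightarrow> real"
  assumes \<kappa>: "\<kappa> \<in> M \<rightarrow>\<^sub>M prob_algebra N" and h: "h \<in> borel_measurable (M \<Otimes>\<^sub>M N)"
  shows "(\<lambda>y. \<integral>\<nu>. h (y, \<nu>) \<partial>\<kappa> y) \<in> borel_measurable M"
proof -
  have "(\<lambda>y. integral\<^sup>L (distr (\<kappa> y) (M \<Otimes>\<^sub>M N) (Pair y)) h) \<in> borel_measurable M"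
    by (rule measurable_compose[OF measurable_prob_algebraD[OF kernel_pair[OF \<kappa>]]
          integral_measurable_subprob_algebra[OF h]])
  also have "?this \<longleftrightarrow> ?thesis"
    by (rule measurable_cong, rule integral_distr[OF kernel_Pair_measurable(1)[OF \<kappa>] h])
  finally show ?thesis .
qed

lemma borel_measurable_bounded_integrable:
  fixes h :: "'a \<Rightarrow> real"
  assumes "finite_measure M" "h \<in> borel_measurable M" "\<And>x. x \<in> space M \<Longrightarrow> \<bar>h x\<bar> \<le> B"
  shows "integrable M h"
  using assms by (intro finite_measure.integrable_const_bound[where B=B]) auto

text \<open>For a function that is not integrable the integral is 0 by convention, and
  \<open>0 \<le> B\<close> covers this case.\<close>

lemma (in prob_space) abs_integral_le_bound:
  fixes h :: "'a \<Rightarrow> real"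
  assumes "AE x in M. \<bar>h x\<bar> \<le> B" "0 \<le> B"
  shows "\<bar>\<integral>x. h x \<partial>M\<bar> \<le> B"
proof (cases "integrable M h")
  case True
  have "\<bar>\<integral>x. h x \<partial>M\<bar> \<le> (\<integral>x. \<bar>h x\<bar> \<partial>M)" by (rule integral_abs_bound)
  also have "\<dots> \<le> (\<integral>x. B \<partial>M)"
    using assms(1) True by (intro integral_mono_AE) auto
  finally show ?thesis by (simp add: prob_space)
qed (use assms in \<open>simp add: not_integrable_integral_eq\<close>)

context homogeneous_law
begin

lemma measurable_restrict_Q: "j \<le> k \<Longrightarrow> (\<lambda>x. restrict x {..<j}) \<in> Q \<rightarrow>\<^sub>M PS {..<j}"
  using measurable_restrict_subset[of "{..<j}" "{..<k}" "\<lambda>_. S"] by (simp cong: measurable_cong_sets)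

lemma measurable_point_masses_Q: "I \<subseteq> {..<k} \<Longrightarrow> point_masses S I \<in> Q \<rightarrow>\<^sub>M counting_algebra S"
  using measurable_point_masses[of I "{..<k}" S] finite_subset[of I "{..<k}"]
  by (simp cong: measurable_cong_sets)

text \<open>\<open>remainder_law\<close> gives the disintegration on rectangles
  \<open>B \<times> C\<close>. These generate the product and are stable under intersection, so the
  joint law of first points and remainder equals the bind of \<open>Q\<close> with \<open>K\<close>;
  integrating \<open>h\<close> against both gives the claim.\<close>

lemma remainder_law_integral:
  fixes h :: "(nat \<Rightarrow> 'a) \<times> 'a measure \<Rightarrow> real"
  assumes R: "remainder_law S k Q j \<kappa>" and j: "j \<le> k"
    and h: "h \<in> borel_measurable (PS {..<j} \<Otimes>\<^sub>M counting_algebra S)"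
    and bound: "\<And>z. z \<in> space (PS {..<j} \<Otimes>\<^sub>M counting_algebra S) \<Longrightarrow> \<bar>h z\<bar> \<le> B"
  shows "(\<integral>x. h (restrict x {..<j}, point_masses S {j..<k} x) \<partial>Q) =
         (\<integral>x. (\<integral>\<nu>. h (restrict x {..<j}, \<nu>) \<partial>\<kappa> (restrict x {..<j})) \<partial>Q)"
proof -
  let ?r = "\<lambda>x. restrict x {..<j}" and ?pm = "point_masses S {j..<k}"
  let ?T = "PS {..<j} \<Otimes>\<^sub>M counting_algebra S"
  interpret Q: prob_space Q by (rule prob_space_Q)
  have \<kappa>: "\<kappa> \<in> PS {..<j} \<rightarrow>\<^sub>M prob_algebra (counting_algebra S)"
    and disint: "\<And>B C. B \<in> sets (PS {..<j}) \<Longrightarrow> C \<in> sets (counting_algebra S) \<Longrightarrow>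
        emeasure Q {x \<in> space Q. ?r x \<in> B \<and> ?pm x \<in> C} =
        (\<integral>\<^sup>+x. emeasure (\<kappa> (?r x)) C * indicator B (?r x) \<partial>Q)"
    using R unfolding remainder_law_def by blast+
  note [measurable] = measurable_restrict_Q[OF j]
  have [measurable]: "?pm \<in> Q \<rightarrow>\<^sub>M counting_algebra S"
    by (rule measurable_point_masses_Q) auto
  define K where "K x = distr (\<kappa> (?r x)) ?T (Pair (?r x))" for x
  have r_space: "?r x \<in> space (PS {..<j})" if "x \<in> space Q" for x
    using measurable_space[OF measurable_restrict_Q[OF j] that] .
  have K: "K \<in> Q \<rightarrow>\<^sub>M prob_algebra ?T"
    unfolding K_def by (rule measurable_compose[OF measurable_restrict_Q[OF j] kernel_pair[OF \<kappa>]])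
  note K' = measurable_prob_algebraD[OF K]
  have Qin: "Q \<in> space (prob_algebra Q)" using prob_space_Q by (simp add: space_prob_algebra)
  have pair: "(\<lambda>x. (?r x, ?pm x)) \<in> Q \<rightarrow>\<^sub>M ?T" by measurable
  have eq: "distr Q ?T (\<lambda>x. (?r x, ?pm x)) = Q \<bind> K"
  proof (rule measure_eqI_generator_eq[OF Int_stable_pair_measure_generator pair_measure_closed,
        where A = "\<lambda>_. space (PS {..<j}) \<times> space (counting_algebra S)"])
    show "sets (distr Q ?T (\<lambda>x. (?r x, ?pm x))) = sigma_sets (space (PS {..<j}) \<times> space (counting_algebra S))
        {a \<times> b |a b. a \<in> sets (PS {..<j}) \<and> b \<in> sets (counting_algebra S)}"
      by (simp add: sets_pair_measure)
    show "sets (Q \<bind> K) = sigma_sets (space (PS {..<j}) \<times> space (counting_algebra S))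
        {a \<times> b |a b. a \<in> sets (PS {..<j}) \<and> b \<in> sets (counting_algebra S)}"
      using sets_bind_measurable[OF K' Q.not_empty] by (simp add: sets_pair_measure)
    fix X assume "X \<in> {a \<times> b |a b. a \<in> sets (PS {..<j}) \<and> b \<in> sets (counting_algebra S)}"
    then obtain B C where X: "X = B \<times> C" and B: "B \<in> sets (PS {..<j})" and C: "C \<in> sets (counting_algebra S)"
      by blast
    have XT: "X \<in> sets ?T" unfolding X using B C by (rule pair_measureI)
    have "emeasure (distr Q ?T (\<lambda>x. (?r x, ?pm x))) X = emeasure Q {x \<in> space Q. ?r x \<in> B \<and> ?pm x \<in> C}"
      by (subst emeasure_distr[OF pair XT]) (rule arg_cong[of _ _ "emeasure Q"], auto simp: X)
    also have "\<dots> = (\<integral>\<^sup>+x. emeasure (\<kappa> (?r x)) C * indicator B (?r x) \<partial>Q)"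
      by (rule disint[OF B C])
    also have "\<dots> = (\<integral>\<^sup>+x. emeasure (K x) X \<partial>Q)"
    proof (rule nn_integral_cong)
      fix x assume x: "x \<in> space Q"
      note * = kernel_Pair_measurable[OF \<kappa> r_space[OF x]]
      have "Pair (?r x) -` X \<inter> space (\<kappa> (?r x)) = (if ?r x \<in> B then C else {})"
        using sets.sets_into_space[OF C] sets_eq_imp_space_eq[OF *(3)] by (auto simp: X)
      then show "emeasure (\<kappa> (?r x)) C * indicator B (?r x) = emeasure (K x) X"
        unfolding K_def by (subst emeasure_distr[OF *(1) XT]) (simp add: indicator_def)
    qed
    also have "\<dots> = emeasure (Q \<bind> K) X"
      by (rule emeasure_bind[OF Q.not_empty K' XT, symmetric])
    finally show "emeasure (distr Q ?T (\<lambda>x. (?r x, ?pm x))) X = emeasure (Q \<bind> K) X" .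
  next
    have "space (PS {..<j}) \<times> space (counting_algebra S) \<in> {a \<times> b |a b. a \<in> sets (PS {..<j}) \<and> b \<in> sets (counting_algebra S)}"
      by blast
    then show "range (\<lambda>_ :: nat. space (PS {..<j}) \<times> space (counting_algebra S))
        \<subseteq> {a \<times> b |a b. a \<in> sets (PS {..<j}) \<and> b \<in> sets (counting_algebra S)}"
      by blast
    show "emeasure (distr Q ?T (\<lambda>x. (?r x, ?pm x))) (space (PS {..<j}) \<times> space (counting_algebra S)) \<noteq> \<infinity>" for i :: nat
      using finite_measure.emeasure_finite[OF Q.finite_measure_distr[OF pair]] by simp
  qed auto
  have "(\<integral>x. h (?r x, ?pm x) \<partial>Q) = integral\<^sup>L (distr Q ?T (\<lambda>x. (?r x, ?pm x))) h"
    by (rule integral_distr[OF pair h, symmetric])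
  also have "\<dots> = (\<integral>x. integral\<^sup>L (K x) h \<partial>Q)"
    unfolding eq
  proof (rule integral_bind[OF h bound K' Q.finite_measure_axioms, where B'=1])
    show "AE x in Q. emeasure (K x) (space (K x)) \<le> ennreal 1"
      using subprob_space.emeasure_space_le_1[OF subprob_space_kernel[OF K']] by (intro AE_I2) simp
  qed
  also have "\<dots> = (\<integral>x. (\<integral>\<nu>. h (?r x, \<nu>) \<partial>\<kappa> (?r x)) \<partial>Q)"
    unfolding K_def
    by (rule Bochner_Integration.integral_cong[OF refl], rule integral_distr[OF kernel_Pair_measurable(1)[OF \<kappa> r_space] h])
  finally show ?thesis .
qed

end

section \<open>Azuma's inequality\<close>

lemma cosh_le_exp_sqr: "(exp y + exp (- y)) / 2 \<le> exp (y\<^sup>2 / 2)" for y :: real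
proof -
  have *: "(exp y + exp (- y)) / 2 \<le> exp (y\<^sup>2 / 2)" if "0 \<le> y" for y :: real
  proof -
    \<comment> \<open>The scalar estimate behind Hoeffding's lemma for a fair two-point
      distribution, taken at \<open>2 * y\<close>; multiplying by \<open>exp (- y)\<close> after
      exponentiation yields the hyperbolic cosine.\<close>
    have "- (2 * y) * (1/2) + ln (1 + (1/2) * (exp (2 * y) - 1)) \<le> (2 * y)\<^sup>2 / 8"
      using Hoeffdings_lemma_aux[of "2 * y" "1/2"] that by simp
    then have "ln ((1 + exp (2 * y)) / 2) \<le> y + y\<^sup>2 / 2"
      by (simp add: field_simps power2_eq_square)
    then have "exp (ln ((1 + exp (2 * y)) / 2)) \<le> exp (y + y\<^sup>2 / 2)"
      by (simp only: exp_le_cancel_iff)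
    moreover have "(1 + exp (2 * y)) / 2 > 0"
      by (simp add: add_pos_pos)
    ultimately have "(1 + exp (2 * y)) / 2 \<le> exp (y + y\<^sup>2 / 2)"
      by (simp only: exp_ln)
    then have "exp (- y) * ((1 + exp (2 * y)) / 2) \<le> exp (- y) * exp (y + y\<^sup>2 / 2)"
      by (intro mult_left_mono) auto
    then show ?thesis
      by (simp add: exp_add[symmetric] field_simps)
  qed
  show ?thesis
    using *[of y] *[of "- y"] by (cases "0 \<le> y") auto
qed

text \<open>By convexity the exponential lies below its chord over [- c, c]. The chord is affine in
  \<open>d\<close>, so for a martingale increment the linear term disappears on integration.\<close>

lemma exp_le_chord:
  fixes l c d :: real
  assumes "c > 0" "\<bar>d\<bar> \<le> c"
  shows "exp (l * d) \<le> (exp (l * c) + exp (- (l * c))) / 2 + d * ((exp (l * c) - exp (- (l * c))) / (2 * c))"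
proof -
  define u where "u = (c + d) / (2 * c)"
  have u: "0 \<le> u" "u \<le> 1" using assms by (auto simp: u_def field_simps abs_le_iff)
  have "l * d = (1 - u) * (- (l * c)) + u * (l * c)"
    using assms by (simp add: u_def field_simps)
  then have "exp (l * d) \<le> (1 - u) * exp (- (l * c)) + u * exp (l * c)"
    using convex_onD[OF convex_on_exp[of 1, simplified], of u "- (l * c)" "l * c"] u by simp
  also have "\<dots> = (exp (l * c) + exp (- (l * c))) / 2 + d * ((exp (l * c) - exp (- (l * c))) / (2 * c))"
    using assms by (simp add: u_def field_simps)
  finally show ?thesis .
qed

text \<open>The hypothesis \<open>martingale\<close> asks that each increment be orthogonal to
  \<open>exp (l * X j x)\<close>, the test function that occurs in the exponential moment argument.
  No filtration has to be set up.\<close>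

lemma (in prob_space) azuma_inequality:
  fixes X :: "nat \<Rightarrow> 'a \<Rightarrow> real" and c B m a :: real and n :: nat
  assumes n: "n \<ge> 1" and c: "c > 0" and a: "a \<ge> 0"
    and meas: "\<And>j. j \<le> n \<Longrightarrow> X j \<in> borel_measurable M"
    and bounded: "\<And>j x. j \<le> n \<Longrightarrow> x \<in> space M \<Longrightarrow> \<bar>X j x\<bar> \<le> B"
    and start: "\<And>x. x \<in> space M \<Longrightarrow> X 0 x = m"
    and increment: "\<And>j x. j < n \<Longrightarrow> x \<in> space M \<Longrightarrow> \<bar>X (Suc j) x - X j x\<bar> \<le> c"
    and martingale: "\<And>j l. j < n \<Longrightarrow>
        (\<integral>x. X (Suc j) x * exp (l * X j x) \<partial>M) = (\<integral>x. X j x * exp (l * X j x) \<partial>M)"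
  shows "measure M {x \<in> space M. X n x - m \<ge> a} \<le> exp (- (a\<^sup>2 / (2 * c\<^sup>2 * n)))"
proof -
  \<comment> \<open>The minimiser of the final exponent
    \<open>n * (l * c)^2 / 2 - l * a\<close>.\<close>
  define l where "l = a / (c\<^sup>2 * n)"
  have l: "l \<ge> 0" using a by (simp add: l_def)
  have exp_bound: "\<bar>exp (l * X j x)\<bar> \<le> exp (l * B)" if "j \<le> n" "x \<in> space M" for j x
    using bounded[OF that] l by (auto intro!: mult_left_mono)
  have int_exp: "integrable M (\<lambda>x. exp (l * X j x))" if "j \<le> n" for j
    using meas[OF that] exp_bound[OF that]
    by (intro borel_measurable_bounded_integrable[OF finite_measure_axioms]) auto
  have int_X_exp: "integrable M (\<lambda>x. X i x * exp (l * X j x))" if "i \<le> n" "j \<le> n" for i j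
  proof (rule borel_measurable_bounded_integrable[OF finite_measure_axioms])
    show "(\<lambda>x. X i x * exp (l * X j x)) \<in> borel_measurable M"
      using meas[OF that(1)] meas[OF that(2)] by measurable
    show "\<bar>X i x * exp (l * X j x)\<bar> \<le> B * exp (l * B)" if "x \<in> space M" for x
      using bounded[OF \<open>i \<le> n\<close> that] exp_bound[OF \<open>j \<le> n\<close> that]
      by (auto simp: abs_mult intro!: mult_mono)
  qed
  have mgf: "(\<integral>x. exp (l * X j x) \<partial>M) \<le> exp (l * m + j * (l * c)\<^sup>2 / 2)" if "j \<le> n" for j
    using that
  proof (induction j)
    case 0
    have "(\<integral>x. exp (l * X 0 x) \<partial>M) = (\<integral>x. exp (l * m) \<partial>M)"
      by (rule Bochner_Integration.integral_cong) (simp_all add: start)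
    then show ?case by (simp add: prob_space)
  next
    case (Suc j)
    define C where "C = (exp (l * c) + exp (- (l * c))) / 2"
    define E where "E = (exp (l * c) - exp (- (l * c))) / (2 * c)"
    have "(\<integral>x. exp (l * X (Suc j) x) \<partial>M)
        \<le> (\<integral>x. C * exp (l * X j x) + E * (X (Suc j) x * exp (l * X j x) - X j x * exp (l * X j x)) \<partial>M)"
    proof (rule integral_mono)
      show "integrable M (\<lambda>x. exp (l * X (Suc j) x))" by (rule int_exp) fact
      show "integrable M (\<lambda>x. C * exp (l * X j x) + E * (X (Suc j) x * exp (l * X j x) - X j x * exp (l * X j x)))"
        using Suc.prems by (intro Bochner_Integration.integrable_add integrable_mult_right
            Bochner_Integration.integrable_diff int_exp int_X_exp) auto
      fix x assume x: "x \<in> space M"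
      have "exp (l * X (Suc j) x) = exp (l * (X (Suc j) x - X j x)) * exp (l * X j x)"
        by (simp add: exp_add[symmetric] algebra_simps)
      also have "\<dots> \<le> (C + (X (Suc j) x - X j x) * E) * exp (l * X j x)"
        unfolding C_def E_def using increment[OF _ x, of j] Suc.prems
        by (intro mult_right_mono exp_le_chord c) auto
      finally show "exp (l * X (Suc j) x) \<le> C * exp (l * X j x) + E * (X (Suc j) x * exp (l * X j x) - X j x * exp (l * X j x))"
        by (simp add: algebra_simps)
    qed
    \<comment> \<open>The factor of \<open>E\<close> integrates to 0 by the martingale identity;
      \<open>C\<close> is cosh (l c).\<close>
    also have "\<dots> = C * (\<integral>x. exp (l * X j x) \<partial>M)"
      using Suc.prems martingale[of j l] int_exp[of j] int_X_exp[of j j] int_X_exp[of "Suc j" j] by simp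
    also have "\<dots> \<le> exp ((l * c)\<^sup>2 / 2) * exp (l * m + j * (l * c)\<^sup>2 / 2)"
      using Suc cosh_le_exp_sqr[of "l * c"] unfolding C_def
      by (intro mult_mono) (auto intro!: Bochner_Integration.integral_nonneg)
    also have "\<dots> = exp (l * m + Suc j * (l * c)\<^sup>2 / 2)"
      by (simp add: exp_add[symmetric] field_simps)
    finally show ?case .
  qed
  have ev: "{x \<in> space M. X n x - m \<ge> a} \<in> sets M"
    using meas[of n] by measurable
  have "measure M {x \<in> space M. X n x - m \<ge> a} = (\<integral>x. indicator {x \<in> space M. X n x - m \<ge> a} x \<partial>M)"
    using ev by simp
  \<comment> \<open>Markov's inequality in exponential form: the integrand is at least 1 on the
    event.\<close>
  also have "\<dots> \<le> (\<integral>x. exp (- (l * (m + a))) * exp (l * X n x) \<partial>M)"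
  proof (rule integral_mono)
    show "integrable M (indicator {x \<in> space M. X n x - m \<ge> a} :: 'a \<Rightarrow> real)"
      using ev by (simp add: integrable_indicator_iff less_top[symmetric])
    show "integrable M (\<lambda>x. exp (- (l * (m + a))) * exp (l * X n x))"
      using int_exp[of n] by simp
    have "1 \<le> exp (- (l * (m + a))) * exp (l * X n x)" if "X n x - m \<ge> a" for x
    proof -
      have "l * (m + a) \<le> l * X n x" using that l by (intro mult_left_mono) auto
      then show ?thesis by (simp add: exp_add[symmetric])
    qed
    then show "indicator {x \<in> space M. X n x - m \<ge> a} x \<le> exp (- (l * (m + a))) * exp (l * X n x)" for x
      by (auto simp: indicator_def)
  qed
  also have "\<dots> \<le> exp (- (l * (m + a))) * exp (l * m + n * (l * c)\<^sup>2 / 2)"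
    using mgf[of n] by simp
  also have "\<dots> = exp (n * (l * c)\<^sup>2 / 2 - l * a)"
    by (simp add: exp_add[symmetric] algebra_simps)
  also have "n * (l * c)\<^sup>2 / 2 - l * a = - (a\<^sup>2 / (2 * c\<^sup>2 * n))"
    using n c by (simp add: l_def field_simps power2_eq_square)
  finally show ?thesis .
qed

section \<open>Moving one point\<close>

lemma sum_measure_partition:
  assumes "finite_measure \<mu>" "finite F" "F \<subseteq> sets \<mu>" "partition_on (space \<mu>) F"
  shows "(\<Sum>A\<in>F. measure \<mu> A) = measure \<mu> (space \<mu>)"
proof -
  have "measure \<mu> (\<Union>A\<in>F. A) = (\<Sum>A\<in>F. measure \<mu> A)"
    using assms by (intro finite_measure.finite_measure_finite_Union)
      (auto simp: partition_on_def disjoint_family_on_def disjoint_def)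
  moreover have "(\<Union>A\<in>F. A) = space \<mu>" using assms(4) by (simp add: partition_on_def)
  ultimately show ?thesis by simp
qed

lemma tv_dist_le:
  assumes "space S \<noteq> {}"
    and "\<And>F. finite F \<Longrightarrow> F \<subseteq> sets S \<Longrightarrow> partition_on (space S) F \<Longrightarrow>
      (\<Sum>A\<in>F. \<bar>measure \<mu> A - measure \<nu> A\<bar>) \<le> c"
  shows "tv_dist S \<mu> \<nu> \<le> c"
  unfolding tv_dist_def
proof (rule cSUP_least)
  \<comment> \<open>A supremum of reals is bounded by its upper bounds only over a nonempty family;
    the trivial partition qualifies because its block is nonempty.\<close>
  have "{space S} \<in> {F. finite F \<and> F \<subseteq> sets S \<and> partition_on (space S) F}"
    using assms(1) by (auto simp: partition_on_def disjoint_def)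
  then show "{F. finite F \<and> F \<subseteq> sets S \<and> partition_on (space S) F} \<noteq> {}" by blast
qed (use assms(2) in blast)

text \<open>This crude diameter bound makes a Lipschitz functional bounded on configurations, which
  settles integrability.\<close>

lemma tv_dist_configurations_le:
  assumes S: "space S \<noteq> {}" and \<mu>: "\<mu> \<in> configurations S k" and \<nu>: "\<nu> \<in> configurations S k"
  shows "tv_dist S \<mu> \<nu> \<le> 2 * k"
proof (rule tv_dist_le[OF S])
  fix F assume F: "finite F" "F \<subseteq> sets S" "partition_on (space S) F"
  have mass: "(\<Sum>A\<in>F. measure \<xi> A) = k" if "\<xi> \<in> configurations S k" for \<xi>
    using sum_measure_partition[OF finite_measure_configurations[OF that] F(1)] F
    by (simp add: configurations_sets[OF that] configurations_space[OF that] measure_configurations[OF that])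
  have "(\<Sum>A\<in>F. \<bar>measure \<mu> A - measure \<nu> A\<bar>) \<le> (\<Sum>A\<in>F. measure \<mu> A + measure \<nu> A)"
  proof (rule sum_mono)
    fix A show "\<bar>measure \<mu> A - measure \<nu> A\<bar> \<le> measure \<mu> A + measure \<nu> A"
      using measure_nonneg[of \<mu> A] measure_nonneg[of \<nu> A] by arith
  qed
  also have "\<dots> = 2 * k"
    unfolding sum.distrib mass[OF \<mu>] mass[OF \<nu>] by simp
  finally show "(\<Sum>A\<in>F. \<bar>measure \<mu> A - measure \<nu> A\<bar>) \<le> 2 * k" .
qed

text \<open>The common part \<open>\<rho>\<close> cancels, leaving a difference of two Dirac masses,
  each of which sums to 1 over a partition. Finiteness of \<open>\<rho>\<close> on measurable sets,
  needed for real subtraction, follows from \<open>\<rho> \<le> \<mu>\<close>.\<close>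

lemma tv_dist_move_point:
  assumes \<mu>: "\<mu> \<in> configurations S k" and \<nu>: "\<nu> \<in> configurations S l"
    and s: "s \<in> space S" and t: "t \<in> space S"
    and \<mu>\<rho>: "\<And>A. A \<in> sets S \<Longrightarrow> emeasure \<mu> A = emeasure \<rho> A + emeasure (return S s) A"
    and \<nu>\<rho>: "\<And>A. A \<in> sets S \<Longrightarrow> emeasure \<nu> A = emeasure \<rho> A + emeasure (return S t) A"
  shows "tv_dist S \<mu> \<nu> \<le> 2"
proof (rule tv_dist_le)
  show "space S \<noteq> {}" using s by auto
  fix F assume F: "finite F" "F \<subseteq> sets S" "partition_on (space S) F"
  have mass: "(\<Sum>A\<in>F. measure (return S u) A) = 1" if "u \<in> space S" for u
  proof -
    interpret prob_space "return S u" using that by (rule prob_space_return)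
    show ?thesis
      using sum_measure_partition[OF finite_measure_axioms F(1)] F prob_space by simp
  qed
  have diff: "measure \<mu> A - measure \<nu> A = measure (return S s) A - measure (return S t) A" if A: "A \<in> sets S" for A
  proof -
    obtain m where m: "emeasure \<mu> A = of_nat m" by (rule configurations_emeasure[OF \<mu>])
    have "emeasure \<rho> A \<le> emeasure \<mu> A" unfolding \<mu>\<rho>[OF A] by simp
    then have fin: "emeasure \<rho> A \<noteq> \<top>" using m by (auto simp: top_unique)
    have "measure \<mu> A = measure \<rho> A + measure (return S s) A"
      using A fin unfolding measure_def \<mu>\<rho>[OF A] by (subst enn2real_plus) (auto simp: less_top[symmetric] indicator_def)
    moreover have "measure \<nu> A = measure \<rho> A + measure (return S t) A"
      using A fin unfolding measure_def \<nu>\<rho>[OF A] by (subst enn2real_plus) (auto simp: less_top[symmetric] indicator_def)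
    ultimately show ?thesis by simp
  qed
  have "(\<Sum>A\<in>F. \<bar>measure \<mu> A - measure \<nu> A\<bar>) \<le> (\<Sum>A\<in>F. measure (return S s) A + measure (return S t) A)"
  proof (rule sum_mono)
    fix A assume "A \<in> F"
    then have "A \<in> sets S" using F(2) by blast
    then show "\<bar>measure \<mu> A - measure \<nu> A\<bar> \<le> measure (return S s) A + measure (return S t) A"
      using diff[of A] measure_nonneg[of "return S s" A] measure_nonneg[of "return S t" A] by arith
  qed
  also have "\<dots> = 2" unfolding sum.distrib mass[OF s] mass[OF t] by simp
  finally show "(\<Sum>A\<in>F. \<bar>measure \<mu> A - measure \<nu> A\<bar>) \<le> 2" .
qed

lemma plus_measure_point_masses_split:
  fixes j k :: nat
  assumes j: "j \<le> k" and x: "x \<in> {..<k} \<rightarrow> space S"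
  shows "plus_measure (point_masses S {..<j} (restrict x {..<j})) (point_masses S {j..<k} x) = point_masses S {..<k} x"
proof (rule configurations_eqI)
  have x1: "restrict x {..<j} \<in> {..<j} \<rightarrow> space S" and x2: "x \<in> {j..<k} \<rightarrow> space S"
    using j by (auto intro!: funcset_mem[OF x])
  show "plus_measure (point_masses S {..<j} (restrict x {..<j})) (point_masses S {j..<k} x)
     \<in> configurations S (card {..<j} + card {j..<k})"
    using point_masses_in_configurations[OF finite_lessThan x1] point_masses_in_configurations[OF finite_atLeastLessThan x2]
    by (rule plus_measure_in_configurations)
  show "point_masses S {..<k} x \<in> configurations S (card {..<k})"
    by (rule point_masses_in_configurations[OF finite_lessThan x])
  fix A assume A: "A \<in> sets S"
  have "{i \<in> {..<k}. x i \<in> A} = {i \<in> {..<j}. restrict x {..<j} i \<in> A} \<union> {i \<in> {j..<k}. x i \<in> A}"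
    (is "?U = ?V \<union> ?W") using j by auto
  moreover have "card (?V \<union> ?W) = card ?V + card ?W"
    by (rule card_Un_disjoint) (simp, simp, force)
  ultimately have "card ?U = card ?V + card ?W"
    by (simp only:)
  then show "emeasure (plus_measure (point_masses S {..<j} (restrict x {..<j})) (point_masses S {j..<k} x)) A
      = emeasure (point_masses S {..<k} x) A"
    by (simp add: emeasure_plus_measure emeasure_point_masses[OF finite_lessThan x1 A]
        emeasure_point_masses[OF finite_atLeastLessThan x2 A] emeasure_point_masses[OF finite_lessThan x A])
qed

lemma emeasure_point_masses_Suc:
  fixes j :: nat
  assumes x: "x \<in> {..<Suc j} \<rightarrow> space S" and A: "A \<in> sets S"
  shows "emeasure (point_masses S {..<Suc j} x) A
       = emeasure (point_masses S {..<j} (restrict x {..<j})) A + emeasure (return S (x j)) A"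
proof -
  have x1: "restrict x {..<j} \<in> {..<j} \<rightarrow> space S"
    using x by auto
  have "{i \<in> {..<Suc j}. x i \<in> A} = {i \<in> {..<j}. restrict x {..<j} i \<in> A} \<union> (if x j \<in> A then {j} else {})"
    by (auto simp: less_Suc_eq)
  then have "card {i \<in> {..<Suc j}. x i \<in> A} = card {i \<in> {..<j}. restrict x {..<j} i \<in> A} + (if x j \<in> A then 1 else 0)"
    by (simp only:) (subst card_Un_disjoint, auto)
  then show ?thesis
    using A by (simp add: emeasure_point_masses[OF finite_lessThan x A] emeasure_point_masses[OF finite_lessThan x1 A])
qed

section \<open>The martingale of conditional expectations\<close>

text \<open>One choice \<open>\<kappa>\<close> of the regular conditional laws serves both purposes:
  \<open>remainder\<close> makes the conditional expectations a martingale, \<open>covering\<close>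
  bounds their increments.\<close>

locale covering_functional = homogeneous_law S k L
  for S :: "'a measure" and k :: nat and L :: "'a measure measure" +
  fixes f :: "'a measure \<Rightarrow> real" and \<kappa> :: "nat \<Rightarrow> (nat \<Rightarrow> 'a) \<Rightarrow> 'a measure measure"
  assumes k: "k \<ge> 1"
    and f_measurable: "f \<in> borel_measurable (restrict_space (counting_algebra S) (configurations S k))"
    and f_lipschitz: "lipschitz1 S k f"
    and remainder: "\<And>j. j \<le> k \<Longrightarrow> remainder_law S k (random_ordering S k L) j (\<kappa> j)"
    and covering: "\<And>j x. j < k \<Longrightarrow> x \<in> space (\<Pi>\<^sub>M i\<in>{..<Suc j}. S) \<Longrightarrow>
      stochastically_covers S (\<kappa> j (restrict x {..<j})) (\<kappa> (Suc j) x)"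
begin

text \<open>Only the values of \<open>f\<close> on configurations are constrained. Extension by 0
  gives a bounded measurable function on all counting measures, including those in the null sets of
  the conditional laws.\<close>

definition f0 :: "'a measure \<Rightarrow> real" where
  "f0 \<mu> = indicator (configurations S k) \<mu> * f \<mu>"

lemma f0_eq: "\<mu> \<in> configurations S k \<Longrightarrow> f0 \<mu> = f \<mu>"
  by (simp add: f0_def)

lemma measurable_f0 [measurable]: "f0 \<in> borel_measurable (counting_algebra S)"
proof -
  have "configurations S k \<inter> space (counting_algebra S) \<in> sets (counting_algebra S)"
    by (rule sets.Int_space_eq2[THEN ssubst]) (auto intro: sets_configurations)
  from borel_measurable_restrict_space_iff[OF this, of f] f_measurable
  show ?thesis by (simp add: f0_def[abs_def])
qed

lemma f0_bounded: obtains B where "B \<ge> 0" "\<And>\<mu>. \<bar>f0 \<mu>\<bar> \<le> B"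
proof (cases "configurations S k = {}")
  case True
  then show ?thesis by (intro that[of 0]) (simp_all add: f0_def)
next
  case False
  then obtain \<nu> where \<nu>: "\<nu> \<in> configurations S k" by blast
  show ?thesis
  proof (rule that[of "\<bar>f \<nu>\<bar> + 2 * k"])
    fix \<mu>
    show "\<bar>f0 \<mu>\<bar> \<le> \<bar>f \<nu>\<bar> + 2 * k"
    proof (cases "\<mu> \<in> configurations S k")
      case True
      have "\<bar>f \<mu> - f \<nu>\<bar> \<le> tv_dist S \<mu> \<nu>"
        using f_lipschitz True \<nu> unfolding lipschitz1_def by blast
      also have "\<dots> \<le> 2 * k" by (rule tv_dist_configurations_le[OF nonempty True \<nu>])
      finally show ?thesis unfolding f0_eq[OF True] by linarith
    qed (simp add: f0_def)
  qed simp
qed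

text \<open>The conditional expectation as a function of the values \<open>y\<close> of the first
  \<open>j\<close> points; composed with \<open>restrict x {..<j}\<close> it is the
  martingale.\<close>

definition G :: "nat \<Rightarrow> (nat \<Rightarrow> 'a) \<Rightarrow> real" where
  "G j y = (\<integral>\<nu>. f0 (plus_measure (point_masses S {..<j} y) \<nu>) \<partial>\<kappa> j y)"

lemma \<kappa>_measurable: "j \<le> k \<Longrightarrow> \<kappa> j \<in> PS {..<j} \<rightarrow>\<^sub>M prob_algebra (counting_algebra S)"
  using remainder unfolding remainder_law_def by blast

lemma \<kappa>_prob: "j \<le> k \<Longrightarrow> y \<in> space (PS {..<j}) \<Longrightarrow> prob_space (\<kappa> j y)"
  using kernel_Pair_measurable(2)[OF \<kappa>_measurable] .

lemma AE_\<kappa>: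
  assumes j: "j \<le> k" and y: "y \<in> space (PS {..<j})"
  shows "AE \<nu> in \<kappa> j y. \<nu> \<in> configurations S (k - j)"
proof -
  have sets: "sets (\<kappa> j y) = sets (counting_algebra S)"
    using kernel_Pair_measurable(3)[OF \<kappa>_measurable[OF j] y] .
  have "AE \<nu> in \<kappa> j y. emeasure \<nu> (space S) = of_nat (k - j)"
    using remainder[OF j] y unfolding remainder_law_def homogeneous_def by blast
  moreover have "AE \<nu> in \<kappa> j y. \<nu> \<in> counting_measures S"
    using sets_eq_imp_space_eq[OF sets] by (intro AE_I2) simp
  ultimately show ?thesis by eventually_elim (simp add: configurations_def)
qed

lemma measurable_f0_plus:
  fixes j :: nat
  shows "(\<lambda>(y, \<nu>). f0 (plus_measure (point_masses S {..<j} y) \<nu>)) \<in> borel_measurable (PS {..<j} \<Otimes>\<^sub>M counting_algebra S)"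
proof -
  have [measurable]: "point_masses S {..<j} \<in> PS {..<j} \<rightarrow>\<^sub>M counting_algebra S"
    by (rule measurable_point_masses) auto
  show ?thesis by measurable
qed

lemma measurable_G: "j \<le> k \<Longrightarrow> G j \<in> borel_measurable (PS {..<j})"
  unfolding G_def using borel_measurable_kernel_integral[OF \<kappa>_measurable measurable_f0_plus] by simp

lemma G_bounded:
  assumes "j \<le> k" "y \<in> space (PS {..<j})" "B \<ge> 0" "\<And>\<mu>. \<bar>f0 \<mu>\<bar> \<le> B"
  shows "\<bar>G j y\<bar> \<le> B"
  unfolding G_def by (rule prob_space.abs_integral_le_bound[OF \<kappa>_prob[OF assms(1,2)]]) (use assms in auto)

lemma restrict_in_space:
  fixes i j :: nat
  assumes "j \<le> i" "x \<in> space (PS {..<i})"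
  shows "restrict x {..<j} \<in> space (PS {..<j})"
  using measurable_space[OF measurable_restrict_subset[of "{..<j}" "{..<i}" "\<lambda>_. S"] assms(2)] assms(1) by simp

lemma G_increment:
  assumes j: "j < k" and x: "x \<in> space (PS {..<Suc j})"
  shows "\<bar>G (Suc j) x - G j (restrict x {..<j})\<bar> \<le> 2"
proof -
  define y where "y = restrict x {..<j}"
  have y: "y \<in> space (PS {..<j})" unfolding y_def by (rule restrict_in_space[OF _ x]) simp
  have xP: "x \<in> {..<Suc j} \<rightarrow> space S" using x by (auto simp: space_PiM)
  have yP: "y \<in> {..<j} \<rightarrow> space S" using y by (auto simp: space_PiM)
  have xj: "x j \<in> space S" using xP by auto
  obtain C where C: "prob_space C" and sets_C: "sets C = sets (counting_algebra S \<Otimes>\<^sub>M counting_algebra S)"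
    and fst_C: "distr C (counting_algebra S) fst = \<kappa> j y"
    and snd_C: "distr C (counting_algebra S) snd = \<kappa> (Suc j) x"
    and cov: "AE (\<mu>, \<nu>) in C. covers S \<mu> \<nu>"
    using covering[OF j x] unfolding stochastically_covers_def y_def by blast
  interpret C: prob_space C by fact
  note measurable_C = measurable_cong_sets[OF sets_C refl]
  have [measurable]: "fst \<in> C \<rightarrow>\<^sub>M counting_algebra S" "snd \<in> C \<rightarrow>\<^sub>M counting_algebra S"
    unfolding measurable_C by auto
  have pm: "point_masses S {..<j} y \<in> configurations S j" "point_masses S {..<Suc j} x \<in> configurations S (Suc j)"
    using point_masses_in_configurations[OF finite_lessThan yP] point_masses_in_configurations[OF finite_lessThan xP]
    by simp_all
  have "point_masses S {..<j} y \<in> space (counting_algebra S)" "point_masses S {..<Suc j} x \<in> space (counting_algebra S)"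
    using pm configurations_subset by auto
  then have f0_plus: "(\<lambda>\<nu>. f0 (plus_measure (point_masses S {..<j} y) \<nu>)) \<in> borel_measurable (counting_algebra S)"
    "(\<lambda>\<nu>. f0 (plus_measure (point_masses S {..<Suc j} x) \<nu>)) \<in> borel_measurable (counting_algebra S)"
    by measurable
  obtain B where B: "B \<ge> 0" "\<And>\<mu>. \<bar>f0 \<mu>\<bar> \<le> B" using f0_bounded by blast
  have int: "integrable C (\<lambda>c. f0 (plus_measure (point_masses S {..<j} y) (fst c)))"
    "integrable C (\<lambda>c. f0 (plus_measure (point_masses S {..<Suc j} x) (snd c)))"
    by (rule borel_measurable_bounded_integrable[OF C.finite_measure_axioms _ B(2)],
        rule measurable_compose[OF _ f0_plus(1)], measurable)
      (rule borel_measurable_bounded_integrable[OF C.finite_measure_axioms _ B(2)],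
        rule measurable_compose[OF _ f0_plus(2)], measurable)
  \<comment> \<open>The marginals of \<open>C\<close> are the two conditional laws, so both
    expectations become integrals over one coupling and can be compared pointwise.\<close>
  have "G (Suc j) x - G j y = (\<integral>c. f0 (plus_measure (point_masses S {..<Suc j} x) (snd c))
      - f0 (plus_measure (point_masses S {..<j} y) (fst c)) \<partial>C)"
    unfolding G_def fst_C[symmetric] snd_C[symmetric]
    by (subst (1 2) integral_distr) (use f0_plus int in simp_all)
  also have "\<bar>\<dots>\<bar> \<le> 2"
  proof (rule C.abs_integral_le_bound)
    have "AE \<mu> in distr C (counting_algebra S) fst. \<mu> \<in> configurations S (k - j)"
      unfolding fst_C using j y by (intro AE_\<kappa>) auto
    then have 1: "AE c in C. fst c \<in> configurations S (k - j)" by (rule AE_distrD[rotated]) measurable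
    have "AE \<mu> in distr C (counting_algebra S) snd. \<mu> \<in> configurations S (k - Suc j)"
      unfolding snd_C using j x by (intro AE_\<kappa>) auto
    then have 2: "AE c in C. snd c \<in> configurations S (k - Suc j)" by (rule AE_distrD[rotated]) measurable
    from cov have 3: "AE c in C. covers S (fst c) (snd c)" by (simp add: case_prod_beta)
    show "AE c in C. \<bar>f0 (plus_measure (point_masses S {..<Suc j} x) (snd c))
      - f0 (plus_measure (point_masses S {..<j} y) (fst c))\<bar> \<le> 2"
      using 1 2 3
    proof eventually_elim
      fix c assume c1: "fst c \<in> configurations S (k - j)" and c2: "snd c \<in> configurations S (k - Suc j)"
        and cc: "covers S (fst c) (snd c)"
      \<comment> \<open>The masses \<open>k - j\<close> and \<open>k - Suc j\<close> differ, so
        \<open>covers\<close> must provide an extra point.\<close>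
      have "fst c \<noteq> snd c"
      proof
        assume "fst c = snd c"
        with c1 c2 have "(of_nat (k - j) :: ennreal) = of_nat (k - Suc j)" by (simp add: configurations_def)
        then have "k - j = k - Suc j" by (rule of_nat_eq_iff[THEN iffD1])
        with j show False by simp
      qed
      with cc obtain s where s: "s \<in> space S"
        and fst_snd: "\<And>A. A \<in> sets S \<Longrightarrow> emeasure (fst c) A = emeasure (snd c) A + emeasure (return S s) A"
        unfolding covers_def by blast
      let ?\<mu> = "plus_measure (point_masses S {..<Suc j} x) (snd c)"
      let ?\<nu> = "plus_measure (point_masses S {..<j} y) (fst c)"
      \<comment> \<open>The \<open>k - 1\<close> shared points: the revealed \<open>x j\<close>
        completes them to \<open>?\<mu>\<close>, the extra point \<open>s\<close> of the coupling to
        \<open>?\<nu>\<close>.\<close>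
      let ?\<rho> = "plus_measure (point_masses S {..<j} y) (snd c)"
      have \<mu>: "?\<mu> \<in> configurations S k"
        using plus_measure_in_configurations[OF pm(2) c2] j by simp
      have \<nu>: "?\<nu> \<in> configurations S k"
        using plus_measure_in_configurations[OF pm(1) c1] j by simp
      have "tv_dist S ?\<mu> ?\<nu> \<le> 2"
      proof (rule tv_dist_move_point[OF \<mu> \<nu> xj s, where \<rho> = ?\<rho>])
        fix A assume A: "A \<in> sets S"
        show "emeasure ?\<mu> A = emeasure ?\<rho> A + emeasure (return S (x j)) A"
          using emeasure_point_masses_Suc[OF xP A] configurations_sets[OF c2]
          by (simp add: emeasure_plus_measure y_def add_ac)
        show "emeasure ?\<nu> A = emeasure ?\<rho> A + emeasure (return S s) A"
          using fst_snd[OF A] configurations_sets[OF c1] configurations_sets[OF c2]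
          by (simp add: emeasure_plus_measure add_ac)
      qed
      moreover have "\<bar>f ?\<mu> - f ?\<nu>\<bar> \<le> tv_dist S ?\<mu> ?\<nu>"
        using f_lipschitz \<mu> \<nu> unfolding lipschitz1_def by blast
      ultimately show "\<bar>f0 ?\<mu> - f0 ?\<nu>\<bar> \<le> 2" unfolding f0_eq[OF \<mu>] f0_eq[OF \<nu>] by linarith
    qed
  qed simp
  finally show ?thesis by (simp add: y_def)
qed

text \<open>After \<open>k\<close> points the remainder has mass 0 almost surely, so it is the zero
  measure and adding it changes nothing.\<close>

lemma G_last:
  assumes x: "x \<in> space (PS {..<k})"
  shows "G k (restrict x {..<k}) = f0 (point_masses S {..<k} x)"
proof -
  have rx: "restrict x {..<k} = x" using x by (auto simp: space_PiM)
  have xP: "x \<in> {..<k} \<rightarrow> space S" using x by (auto simp: space_PiM)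
  have pm: "point_masses S {..<k} x \<in> configurations S k"
    using point_masses_in_configurations[OF finite_lessThan xP] by simp
  interpret prob_space "\<kappa> k x" using x by (intro \<kappa>_prob) auto
  have sets: "sets (\<kappa> k x) = sets (counting_algebra S)"
    using kernel_Pair_measurable(3)[OF \<kappa>_measurable[OF order_refl] x] .
  have "point_masses S {..<k} x \<in> space (counting_algebra S)" using pm configurations_subset by auto
  then have "(\<lambda>\<nu>. f0 (plus_measure (point_masses S {..<k} x) \<nu>)) \<in> borel_measurable (counting_algebra S)"
    by measurable
  then have meas: "(\<lambda>\<nu>. f0 (plus_measure (point_masses S {..<k} x) \<nu>)) \<in> borel_measurable (\<kappa> k x)"
    using measurable_cong_sets[OF sets refl] by blast
  have "AE \<nu> in \<kappa> k x. f0 (plus_measure (point_masses S {..<k} x) \<nu>) = f0 (point_masses S {..<k} x)"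
    using AE_\<kappa>[OF order_refl x]
  proof eventually_elim
    fix \<nu> assume \<nu>: "\<nu> \<in> configurations S (k - k)"
    have "plus_measure (point_masses S {..<k} x) \<nu> = point_masses S {..<k} x"
    proof (rule configurations_eqI[OF plus_measure_in_configurations[OF pm \<nu>] pm])
      fix A assume "A \<in> sets S"
      obtain n where "n \<le> k - k" "emeasure \<nu> A = of_nat n" by (rule configurations_emeasure[OF \<nu>])
      then show "emeasure (plus_measure (point_masses S {..<k} x) \<nu>) A = emeasure (point_masses S {..<k} x) A"
        using configurations_sets[OF \<nu>] by (simp add: emeasure_plus_measure)
    qed
    then show "f0 (plus_measure (point_masses S {..<k} x) \<nu>) = f0 (point_masses S {..<k} x)" by simp
  qed
  then have "G k x = (\<integral>\<nu>. f0 (point_masses S {..<k} x) \<partial>\<kappa> k x)"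
    unfolding G_def by (intro integral_cong_AE meas) auto
  then show ?thesis unfolding rx by (simp add: prob_space)
qed

text \<open>The defining property of a conditional expectation, for bounded functions of the first
  \<open>j\<close> points. Given these, \<open>h\<close> is constant and leaves the inner integral
  of \<open>remainder_law_integral\<close>.\<close>

lemma G_test_function:
  assumes j: "j \<le> k" and h: "h \<in> borel_measurable (PS {..<j})"
    and bound: "\<And>y. y \<in> space (PS {..<j}) \<Longrightarrow> \<bar>h y\<bar> \<le> K"
  shows "(\<integral>x. f0 (point_masses S {..<k} x) * h (restrict x {..<j}) \<partial>Q) =
         (\<integral>x. G j (restrict x {..<j}) * h (restrict x {..<j}) \<partial>Q)"
proof -
  obtain B where B: "B \<ge> 0" "\<And>\<mu>. \<bar>f0 \<mu>\<bar> \<le> B" using f0_bounded by blast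
  define H where "H = (\<lambda>(y, \<nu>). f0 (plus_measure (point_masses S {..<j} y) \<nu>) * h y)"
  have "(\<integral>x. f0 (point_masses S {..<k} x) * h (restrict x {..<j}) \<partial>Q)
      = (\<integral>x. H (restrict x {..<j}, point_masses S {j..<k} x) \<partial>Q)"
  proof (rule Bochner_Integration.integral_cong[OF refl])
    fix x assume "x \<in> space Q"
    then have "x \<in> {..<k} \<rightarrow> space S" by (auto simp: space_PiM)
    from plus_measure_point_masses_split[OF j this]
    show "f0 (point_masses S {..<k} x) * h (restrict x {..<j}) = H (restrict x {..<j}, point_masses S {j..<k} x)"
      by (simp add: H_def)
  qed
  also have "\<dots> = (\<integral>x. (\<integral>\<nu>. H (restrict x {..<j}, \<nu>) \<partial>\<kappa> j (restrict x {..<j})) \<partial>Q)"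
  proof (rule remainder_law_integral[OF remainder[OF j] j])
    have "(\<lambda>z. (case z of (y, \<nu>) \<Rightarrow> f0 (plus_measure (point_masses S {..<j} y) \<nu>)) * h (fst z))
        \<in> borel_measurable (PS {..<j} \<Otimes>\<^sub>M counting_algebra S)"
      by (rule borel_measurable_times[OF measurable_f0_plus measurable_compose[OF measurable_fst h]])
    then show "H \<in> borel_measurable (PS {..<j} \<Otimes>\<^sub>M counting_algebra S)"
      by (simp add: H_def case_prod_beta')
    fix z assume "z \<in> space (PS {..<j} \<Otimes>\<^sub>M counting_algebra S)"
    then have "\<bar>h (fst z)\<bar> \<le> K" by (intro bound) (auto simp: space_pair_measure)
    then show "\<bar>H z\<bar> \<le> B * K"
      unfolding H_def case_prod_beta abs_mult by (intro mult_mono B) auto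
  qed
  also have "\<dots> = (\<integral>x. G j (restrict x {..<j}) * h (restrict x {..<j}) \<partial>Q)"
    by (simp add: H_def G_def)
  finally show ?thesis .
qed

lemma concentration:
  assumes a: "a \<ge> 0"
  shows "measure L {\<mu> \<in> space L. f0 \<mu> - (\<integral>\<mu>. f0 \<mu> \<partial>L) \<ge> a} \<le> exp (- (a\<^sup>2 / (8 * real k)))"
proof -
  interpret Q: prob_space Q by (rule prob_space_Q)
  obtain B where B: "B \<ge> 0" "\<And>\<mu>. \<bar>f0 \<mu>\<bar> \<le> B" using f0_bounded by blast
  have pm: "point_masses S {..<k} \<in> Q \<rightarrow>\<^sub>M counting_algebra S"
    by (rule measurable_point_masses_Q) auto
  \<comment> \<open>For \<open>j = 0\<close> the index set is empty and
    \<open>\<lambda>_. undefined\<close> is the only point of the product, so the martingale starts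
    at a constant; testing with the function 1 identifies it as the mean.\<close>
  define m where "m = G 0 (\<lambda>_. undefined)"
  define X where "X j x = G j (restrict x {..<j})" for j x
  have X_bounded: "\<bar>X j x\<bar> \<le> B" if "j \<le> k" "x \<in> space Q" for j x
    unfolding X_def using that restrict_in_space[of j k] by (intro G_bounded B) auto
  have mean: "(\<integral>\<mu>. f0 \<mu> \<partial>L) = m"
  proof -
    have "(\<integral>\<mu>. f0 \<mu> \<partial>L) = (\<integral>x. f0 (point_masses S {..<k} x) \<partial>Q)"
      by (subst distr_point_masses_Q[symmetric]) (rule integral_distr[OF pm measurable_f0])
    also have "\<dots> = (\<integral>x. m \<partial>Q)"
      using G_test_function[of 0 "\<lambda>_. 1" 1] by (simp add: m_def restrict_def)
    also have "\<dots> = m" using Q.prob_space by simp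
    finally show ?thesis .
  qed
  have "Q.prob {x \<in> space Q. X k x - m \<ge> a} \<le> exp (- (a\<^sup>2 / (2 * 2\<^sup>2 * real k)))"
  proof (rule Q.azuma_inequality[OF k _ a])
    show "X j \<in> borel_measurable Q" if "j \<le> k" for j
      unfolding X_def using measurable_compose[OF measurable_restrict_Q[OF that] measurable_G[OF that]] .
    show "\<bar>X j x\<bar> \<le> B" if "j \<le> k" "x \<in> space Q" for j x
      using X_bounded that .
    show "X 0 x = m" for x by (simp add: X_def m_def restrict_def)
    show "\<bar>X (Suc j) x - X j x\<bar> \<le> 2" if j: "j < k" and x: "x \<in> space Q" for j x
    proof -
      have "restrict x {..<Suc j} \<in> space (PS {..<Suc j})"
        using x j by (intro restrict_in_space[of _ k]) auto
      moreover have "restrict (restrict x {..<Suc j}) {..<j} = restrict x {..<j}"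
        by (auto simp: fun_eq_iff)
      ultimately show ?thesis
        using G_increment[OF j, of "restrict x {..<Suc j}"] by (simp add: X_def)
    qed
    fix j l assume j: "j < k"
    define h where "h y = exp (l * G j y)" for y
    have h: "h \<in> borel_measurable (PS {..<j})"
    proof -
      have [measurable]: "G j \<in> borel_measurable (PS {..<j})" using j by (intro measurable_G) simp
      show ?thesis unfolding h_def by measurable
    qed
    have h_bound: "\<bar>h y\<bar> \<le> exp (\<bar>l\<bar> * B)" if "y \<in> space (PS {..<j})" for y
    proof -
      have "l * G j y \<le> \<bar>l\<bar> * \<bar>G j y\<bar>" by (metis abs_ge_self abs_mult)
      also have "\<dots> \<le> \<bar>l\<bar> * B" using G_bounded[OF _ that B] j by (intro mult_left_mono) auto
      finally show ?thesis by (simp add: h_def)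
    qed
    have rr: "restrict (restrict x {..<Suc j}) {..<j} = restrict x {..<j}" for x :: "nat \<Rightarrow> 'a"
      by (auto simp: fun_eq_iff)
    \<comment> \<open>The tower property: \<open>h\<close> depends on the first \<open>j\<close>
      points, hence also on the first \<open>j + 1\<close>, and both levels give the same integral
      of \<open>f0\<close> times \<open>h\<close>.\<close>
    have "(\<integral>x. f0 (point_masses S {..<k} x) * h (restrict x {..<j}) \<partial>Q)
        = (\<integral>x. G j (restrict x {..<j}) * h (restrict x {..<j}) \<partial>Q)"
      using j by (intro G_test_function[where K = "exp (\<bar>l\<bar> * B)"] h h_bound) auto
    moreover have "(\<integral>x. f0 (point_masses S {..<k} x) * h (restrict (restrict x {..<Suc j}) {..<j}) \<partial>Q)
        = (\<integral>x. G (Suc j) (restrict x {..<Suc j}) * h (restrict (restrict x {..<Suc j}) {..<j}) \<partial>Q)"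
    proof (rule G_test_function)
      show "(\<lambda>y. h (restrict y {..<j})) \<in> borel_measurable (PS {..<Suc j})"
        by (rule measurable_compose[OF measurable_restrict_subset h]) auto
      show "\<bar>h (restrict y {..<j})\<bar> \<le> exp (\<bar>l\<bar> * B)" if "y \<in> space (PS {..<Suc j})" for y
        by (rule h_bound, rule restrict_in_space[OF _ that]) simp
    qed (use j in simp)
    ultimately show "(\<integral>x. X (Suc j) x * exp (l * X j x) \<partial>Q) = (\<integral>x. X j x * exp (l * X j x) \<partial>Q)"
      by (simp only: rr X_def h_def)
  qed simp
  moreover have "measure L {\<mu> \<in> space L. f0 \<mu> - (\<integral>\<mu>. f0 \<mu> \<partial>L) \<ge> a} = Q.prob {x \<in> space Q. X k x - m \<ge> a}"
  proof -
    have W: "{\<mu> \<in> space L. f0 \<mu> - m \<ge> a} \<in> sets (counting_algebra S)"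
      unfolding space_L space_counting_algebra[symmetric] by measurable
    have "measure L {\<mu> \<in> space L. f0 \<mu> - m \<ge> a}
        = measure (distr Q (counting_algebra S) (point_masses S {..<k})) {\<mu> \<in> space L. f0 \<mu> - m \<ge> a}"
      by (simp only: distr_point_masses_Q)
    also have "\<dots> = Q.prob (point_masses S {..<k} -` {\<mu> \<in> space L. f0 \<mu> - m \<ge> a} \<inter> space Q)"
      by (rule measure_distr[OF pm W])
    also have "point_masses S {..<k} -` {\<mu> \<in> space L. f0 \<mu> - m \<ge> a} \<inter> space Q = {x \<in> space Q. X k x - m \<ge> a}"
      using measurable_space[OF pm] by (auto simp: X_def G_last space_L)
    finally show ?thesis unfolding mean .
  qed
  ultimately show ?thesis by simp
qed

end

section \<open>From the law back to the process\<close>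

theorem theorem3p4:
  fixes S :: "'a measure" and P :: "'w measure" and Z :: "'w \<Rightarrow> 'a measure"
    and f :: "'a measure \<Rightarrow> real" and k :: nat and a :: real
  assumes "k \<ge> 1"
    and "standard_borel S"
    and "homogeneous S k P Z"
    and "f \<in> borel_measurable (restrict_space (counting_algebra S) (configurations S k))"
    and "lipschitz1 S k f"
    and "stochastic_covering_property S k (distr P (counting_algebra S) Z)"
    and "a \<ge> 0"
  shows "measure P {\<omega> \<in> space P. Z \<omega> \<in> configurations S k \<and>
            f (Z \<omega>) - (LINT \<omega>':{\<omega>' \<in> space P. Z \<omega>' \<in> configurations S k}|P. f (Z \<omega>')) \<ge> a}
         \<le> exp (- (a\<^sup>2 / (8 * real k)))"
proof -
  define L where "L = distr P (counting_algebra S) Z"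
  have P: "prob_space P" and Z: "Z \<in> P \<rightarrow>\<^sub>M counting_algebra S"
    and mass: "AE \<omega> in P. emeasure (Z \<omega>) (space S) = of_nat k"
    using assms(3) by (auto simp: homogeneous_def point_process_def)
  interpret P: prob_space P by (rule P)
  have conf: "AE \<omega> in P. Z \<omega> \<in> configurations S k"
    using mass AE_space by eventually_elim (use measurable_space[OF Z] in \<open>auto simp: configurations_def\<close>)
  have "space S \<noteq> {}"
  proof
    assume "space S = {}"
    with mass assms(1) have "AE \<omega> in P. False" by simp
    then show False using P.AE_False by simp
  qed
  obtain \<kappa> where \<kappa>: "\<forall>j\<le>k. remainder_law S k (random_ordering S k L) j (\<kappa> j)"
    "\<forall>j<k. \<forall>x\<in>space (\<Pi>\<^sub>M i\<in>{..<Suc j}. S). stochastically_covers S (\<kappa> j (restrict x {..<j})) (\<kappa> (Suc j) x)"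
    using assms(6) unfolding stochastic_covering_property_def L_def by blast
  have sets_L: "sets L = sets (counting_algebra S)" by (simp add: L_def)
  have space_L: "space L = counting_measures S" using sets_eq_imp_space_eq[OF sets_L] by simp
  have "{\<mu> \<in> space (counting_algebra S). \<mu> \<in> configurations S k} \<in> sets (counting_algebra S)" by measurable
  with conf have AE_L: "AE \<mu> in L. \<mu> \<in> configurations S k"
    unfolding L_def by (subst AE_distr_iff[OF Z])
  have "prob_space L" unfolding L_def by (rule P.prob_space_distr[OF Z])
  then have "homogeneous_law S k L"
    using assms(2) \<open>space S \<noteq> {}\<close> sets_L AE_L by (intro homogeneous_law.intro)
  moreover have "covering_functional_axioms S k L f \<kappa>"
    by (rule covering_functional_axioms.intro) (use assms(1,4,5) \<kappa> in blast)+
  ultimately interpret covering_functional S k L f \<kappa>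
    by (rule covering_functional.intro)
  \<comment> \<open>The indicator of the domain of integration is the one built into
    \<open>f0\<close>.\<close>
  have mean: "(LINT \<omega>':{\<omega>' \<in> space P. Z \<omega>' \<in> configurations S k}|P. f (Z \<omega>')) = (\<integral>\<mu>. f0 \<mu> \<partial>L)"
    unfolding L_def integral_distr[OF Z measurable_f0] set_lebesgue_integral_def
    by (rule Bochner_Integration.integral_cong) (auto simp: f0_def indicator_def)
  \<comment> \<open>An inclusion is enough; it may be strict, because off the configurations
    \<open>f0\<close> is 0, which can also reach the threshold.\<close>
  have "P.prob {\<omega> \<in> space P. Z \<omega> \<in> configurations S k \<and> f (Z \<omega>) - (\<integral>\<mu>. f0 \<mu> \<partial>L) \<ge> a}
      \<le> P.prob (Z -` {\<mu> \<in> space L. f0 \<mu> - (\<integral>\<mu>. f0 \<mu> \<partial>L) \<ge> a} \<inter> space P)"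
  proof (rule P.finite_measure_mono)
    show "{\<omega> \<in> space P. Z \<omega> \<in> configurations S k \<and> f (Z \<omega>) - (\<integral>\<mu>. f0 \<mu> \<partial>L) \<ge> a}
      \<subseteq> Z -` {\<mu> \<in> space L. f0 \<mu> - (\<integral>\<mu>. f0 \<mu> \<partial>L) \<ge> a} \<inter> space P"
      using measurable_space[OF Z] by (auto simp: f0_eq space_L)
    show "Z -` {\<mu> \<in> space L. f0 \<mu> - (\<integral>\<mu>. f0 \<mu> \<partial>L) \<ge> a} \<inter> space P \<in> sets P"
      by (rule measurable_sets[OF Z]) (unfold space_L space_counting_algebra[symmetric], measurable)
  qed
  also have "\<dots> = measure L {\<mu> \<in> space L. f0 \<mu> - (\<integral>\<mu>. f0 \<mu> \<partial>L) \<ge> a}"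
  proof -
    have "{\<mu> \<in> space L. f0 \<mu> - (\<integral>\<mu>. f0 \<mu> \<partial>L) \<ge> a} \<in> sets (counting_algebra S)"
      unfolding space_L space_counting_algebra[symmetric] by measurable
    from measure_distr[OF Z this] show ?thesis unfolding L_def by simp
  qed
  also have "\<dots> \<le> exp (- (a\<^sup>2 / (8 * real k)))" by (rule concentration[OF assms(7)])
  finally show ?thesis unfolding mean .
qed

end
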